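(* With the notation and standing assumptions of the context, consider the condition $$(\ast)\qquad \ker\varphi_1\not\subset\ker\varphi_2\ \text{ if }\ \varphi_2\not\equiv 0,\qquad\text{and}\qquad \ker\varphi_2\not\subset\ker\varphi_1\ \text{ if }\ \varphi_1\not\equiv 0 .$$ The pair $(\tilde{\cal C},[\cdot,\cdot])$ forms a simple Lie superalgebra if $\varepsilon=1$, or if $\varepsilon=0$, $\alpha_0\neq 0$ and $(\ast)$ holds. Moreover, the codimension of $\tilde{\cal B}$ in $\tilde{\cal A}$ is at most $1$ under the condition $(\ast)$.
   Context: $\mathbb{F}$ is a field of characteristic $0$, all vector spaces are over $\mathbb{F}$, and $\mathbb{N}=\{0,1,2,\dots\}$. Let $\Gamma$ be a torsion-free abelian group ($\Gamma=\{0\}$ is allowed). Let $\alpha_0\in\Gamma$ and $\varepsilon\in\{0,1\}\subset\mathbb{F}$ be fixed. For $p\in\{1,2\}$ let ${\cal J}_p\in\{\{0\},\mathbb{N}\}$ (i.e. ${\cal J}_p$ is either $\{0\}$ or $\mathbb{N}$), and let $\varphi_p:\Gamma\to\mathbb{F}$ be additive group homomorphisms such that - $\ker\varphi_1\cap\ker\varphi_2=\{0\}$; - if $\varepsilon=0$: $\varphi_p\not\equiv 0$ whenever ${\cal J}_p=\{0\}$, for both $p=1$ and $p=2$; - if $\varepsilon=1$: $\varphi_1\not\equiv 0$ whenever ${\cal J}_1=\{0\}$ (no such condition is required for $p=2$; the case $\varphi_2\equiv 0$, ${\cal J}_2=\{0\}$ is allowed). Put $\vec{\cal J}={\cal J}_1\times{\cal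 J}_2$ with componentwise addition, write $\vec i=(i_1,i_2)$ and $\vec 0=(0,0)$, and set $1_{[1]}=(1,0)$, $1_{[2]}=(0,1)$ (as index vectors). Let ${\cal A}_2$ be the vector space with basis $\{x^{\alpha,\vec i}\mid(\alpha,\vec i)\in\Gamma\times\vec{\cal J}\}$. It is a commutative associative algebra with product $x^{\alpha,\vec i}\cdot x^{\beta,\vec j}=x^{\alpha+\beta,\vec i+\vec j}$ and identity $1=x^{0,\vec 0}$. For $p=1,2$ let $\partial_p$ be the derivation of ${\cal A}_2$ given by $$\partial_p(x^{\alpha,\vec i})=\varphi_p(\alpha)x^{\alpha,\vec i}+i_p\,x^{\alpha,\vec i-1_{[p]}},$$ where a symbol $x^{\alpha,\vec l}$ with $\vec l\notin\vec{\cal J}$ is treated as zero. Set $\tilde{\cal A}={\cal A}_2\times{\cal A}_2=\tilde{\cal A}_0\oplus\tilde{\cal A}_1$ with even part $\tilde{\cal A}_0=({\cal A}_2,0)$ and odd part $\tilde{\cal A}_1=(0,{\cal A}_2)$, and for $u\in{\cal A}_2$ write $u_{[0]}=(u,0)$, $u_{[1]}=(0,u)$. Define a bilinear bracket on $\tilde{\cal A}$ by, for $u,v\in{\cal A}_2$, $$[u_{[0]},v_{[0]}]=\big[\partial_1(u)\partial_2(v)-\partial_1(v)\partial_2(u)+\varepsilon(u\,\partial_1(v)-\partial_1(u)\,v)\big]_{[0]},$$ $$[u_{[1]},v_{[1]}]=(x^{\alpha_0,\vec 0}uv)_{[0]},$$ $$[u_{[0]},v_{[1]}]=-[v_{[1]},u_{[0]}]=\Big[\partial_1(u)\partial_2(v)-\partial_1(v)\partial_2(u)+\varepsilon\big(u\,\partial_1(v)-\tfrac12\partial_1(u)\,v\big)+\tfrac12\big(\varphi_2(\alpha_0)\partial_1(u)\,v+\varphi_1(\alpha_0)(\varepsilon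 uv-\partial_2(u)\,v)\big)\Big]_{[1]}.$$ Then $(\tilde{\cal A},[\cdot,\cdot])$ is a Lie superalgebra. Set $\tilde{\cal B}_1=[\tilde{\cal A}_0,\tilde{\cal A}_1]$ (the linear span of such brackets) and $\tilde{\cal B}=\tilde{\cal A}_0+\tilde{\cal B}_1$, which is a subalgebra of $\tilde{\cal A}$. Let $\sigma_1$ denote the element of $\ker\varphi_1$ with $\varphi_2(\sigma_1)=1$, if it exists (it is then unique); if it does not exist, $x^{\sigma_1,\vec 0}$ is understood to be $0$. The element $1_{[0]}$ (that is, $(1,0)$ with $1=x^{0,\vec 0}$) is central in $\tilde{\cal A}$ when $\varepsilon=0$, and $(x^{\sigma_1,\vec 0})_{[0]}$ is central in $\tilde{\cal A}$ when $\varepsilon=1$. Define the quotient Lie superalgebra $$\tilde{\cal C}=\begin{cases}\tilde{\cal B}/\mathbb{F}1_{[0]}&\text{if }\varepsilon=0,\\ \tilde{\cal B}/\mathbb{F}(x^{\sigma_1,\vec 0})_{[0]}&\text{if }\varepsilon=1,\end{cases}$$ with the induced bracket $[\cdot,\cdot]$. *)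

theory Defs
  imports
    "HOL-Algebra.Module"
    "HOL-Algebra.QuotRing"
    "HOL-Algebra.Algebraic_Closure_Type"
    "HOL-Library.Poly_Mapping"
    "HOL-Library.Product_Plus"
    "HOL-Library.Extended_Nat"
begin

section \<open>Lie superalgebras over a field\<close>

text \<open>
  The multiplication of the underlying record is the Lie superbracket; the \<open>one\<close> field,
  inherited from \<open>ring\<close>, plays no role. Parities are booleans (\<open>True\<close> is odd), so the
  sum of parities is \<open>i \<noteq> j\<close> and their product is \<open>i \<and> j\<close>. In characteristic \<open>2\<close> or \<open>3\<close>
  further axioms would be customary.
\<close>

record ('k, 'v) superalgebra = "('k, 'v) module" +
  grade :: "bool \<Rightarrow> 'v set"

locale lie_superalgebra = field K + module K L
  for K :: "('k, 'm) ring_scheme" (structure)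
    and L :: "('k, 'v, 'n) superalgebra_scheme" (structure) +
  assumes grade_submodule: "submodule (grade L i) K L"
    and grade_sum: "carrier L = grade L False <+>\<^bsub>L\<^esub> grade L True"
    and grade_inter: "grade L False \<inter> grade L True = {\<zero>\<^bsub>L\<^esub>}"
    and bracket_closed:
      "x \<in> carrier L \<Longrightarrow> y \<in> carrier L \<Longrightarrow> x \<otimes>\<^bsub>L\<^esub> y \<in> carrier L"
    and bracket_add_left:
      "x \<in> carrier L \<Longrightarrow> y \<in> carrier L \<Longrightarrow> z \<in> carrier L \<Longrightarrow>
        (x \<oplus>\<^bsub>L\<^esub> y) \<otimes>\<^bsub>L\<^esub> z = (x \<otimes>\<^bsub>L\<^esub> z) \<oplus>\<^bsub>L\<^esub> (y \<otimes>\<^bsub>L\<^esub> z)"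
    and bracket_add_right:
      "x \<in> carrier L \<Longrightarrow> y \<in> carrier L \<Longrightarrow> z \<in> carrier L \<Longrightarrow>
        x \<otimes>\<^bsub>L\<^esub> (y \<oplus>\<^bsub>L\<^esub> z) = (x \<otimes>\<^bsub>L\<^esub> y) \<oplus>\<^bsub>L\<^esub> (x \<otimes>\<^bsub>L\<^esub> z)"
    and bracket_smult_left:
      "c \<in> carrier K \<Longrightarrow> x \<in> carrier L \<Longrightarrow> y \<in> carrier L \<Longrightarrow>
        (c \<odot>\<^bsub>L\<^esub> x) \<otimes>\<^bsub>L\<^esub> y = c \<odot>\<^bsub>L\<^esub> (x \<otimes>\<^bsub>L\<^esub> y)"
    and bracket_smult_right:
      "c \<in> carrier K \<Longrightarrow> x \<in> carrier L \<Longrightarrow> y \<in> carrier L \<Longrightarrow>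
        x \<otimes>\<^bsub>L\<^esub> (c \<odot>\<^bsub>L\<^esub> y) = c \<odot>\<^bsub>L\<^esub> (x \<otimes>\<^bsub>L\<^esub> y)"
    and bracket_grade:
      "x \<in> grade L i \<Longrightarrow> y \<in> grade L j \<Longrightarrow> x \<otimes>\<^bsub>L\<^esub> y \<in> grade L (i \<noteq> j)"
    and super_skew:
      "x \<in> grade L i \<Longrightarrow> y \<in> grade L j \<Longrightarrow>
        x \<otimes>\<^bsub>L\<^esub> y = (if i \<and> j then y \<otimes>\<^bsub>L\<^esub> x else \<ominus>\<^bsub>L\<^esub> (y \<otimes>\<^bsub>L\<^esub> x))"
    and super_jacobi:
      "x \<in> grade L i \<Longrightarrow> y \<in> grade L j \<Longrightarrow> z \<in> grade L k \<Longrightarrow>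
        x \<otimes>\<^bsub>L\<^esub> (y \<otimes>\<^bsub>L\<^esub> z) =
          ((x \<otimes>\<^bsub>L\<^esub> y) \<otimes>\<^bsub>L\<^esub> z) \<oplus>\<^bsub>L\<^esub>
          (if i \<and> j then \<ominus>\<^bsub>L\<^esub> (y \<otimes>\<^bsub>L\<^esub> (x \<otimes>\<^bsub>L\<^esub> z)) else y \<otimes>\<^bsub>L\<^esub> (x \<otimes>\<^bsub>L\<^esub> z))"

definition graded_ideal ::
    "('k, 'm) ring_scheme \<Rightarrow> 'v set \<Rightarrow> ('k, 'v, 'n) superalgebra_scheme \<Rightarrow> bool" where
  "graded_ideal K I L \<longleftrightarrow>
     submodule I K L \<and>
     I = (I \<inter> grade L False) <+>\<^bsub>L\<^esub> (I \<inter> grade L True) \<and>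
     (\<forall>a\<in>carrier L. \<forall>x\<in>I. a \<otimes>\<^bsub>L\<^esub> x \<in> I \<and> x \<otimes>\<^bsub>L\<^esub> a \<in> I)"

definition simple_lie_superalgebra ::
    "('k, 'm) ring_scheme \<Rightarrow> ('k, 'v, 'n) superalgebra_scheme \<Rightarrow> bool" where
  "simple_lie_superalgebra K L \<longleftrightarrow>
     lie_superalgebra K L \<and>
     (\<exists>x\<in>carrier L. \<exists>y\<in>carrier L. x \<otimes>\<^bsub>L\<^esub> y \<noteq> \<zero>\<^bsub>L\<^esub>) \<and>
     (\<forall>I. graded_ideal K I L \<longrightarrow> I = {\<zero>\<^bsub>L\<^esub>} \<or> I = carrier L)"

text \<open>
  The elements of the quotient are the cosets of \<open>N\<close>. If \<open>N\<close> is merely a subspace, only the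
  linear structure of the result is meaningful.
\<close>

definition quotient_superalgebra ::
    "('k, 'v, 'n) superalgebra_scheme \<Rightarrow> 'v set \<Rightarrow> ('k, 'v set) superalgebra" where
  "quotient_superalgebra L N =
     \<lparr>carrier = a_rcosets\<^bsub>L\<^esub> N, monoid.mult = rcoset_mult L N, one = N, zero = N, add = set_add L,
      module.smult = (\<lambda>c S. \<Union>x\<in>S. N +>\<^bsub>L\<^esub> (c \<odot>\<^bsub>L\<^esub> x)),
      grade = (\<lambda>i. (\<lambda>x. N +>\<^bsub>L\<^esub> x) ` grade L i)\<rparr>"

definition lin_span ::
    "('k, 'm) ring_scheme \<Rightarrow> ('k, 'v, 'n) module_scheme \<Rightarrow> 'v set \<Rightarrow> 'v set" where
  "lin_span K V S = (\<lambda>H. submodule H K V) hull S"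

text \<open>The dimension is the least cardinality of a finite spanning set, and \<open>\<infinity>\<close> if there is none.\<close>

definition lin_dim ::
    "('k, 'm) ring_scheme \<Rightarrow> ('k, 'v, 'n) module_scheme \<Rightarrow> enat" where
  "lin_dim K V = Inf {enat (card S) | S. finite S \<and> S \<subseteq> carrier V \<and> lin_span K V S = carrier V}"

definition codimension ::
    "('k, 'm) ring_scheme \<Rightarrow> ('k, 'v, 'n) superalgebra_scheme \<Rightarrow> 'v set \<Rightarrow> enat" where
  "codimension K V W = lin_dim K (quotient_superalgebra V W)"


section \<open>The commutative algebra and its derivations\<close>

text \<open>
  Elements are finitely supported functions on \<open>\<Gamma> \<times> \<nat> \<times> \<nat>\<close>, with the convolution product of
  \<^theory>\<open>HOL-Library.Poly_Mapping\<close>; the index sets \<open>J1\<close> and \<open>J2\<close> enter through the support.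
\<close>

type_synonym ('g, 'k) alg = "('g \<times> nat \<times> nat) \<Rightarrow>\<^sub>0 'k"

definition alg_carrier :: "nat set \<Rightarrow> nat set \<Rightarrow> ('g, 'k::zero) alg set" where
  "alg_carrier J1 J2 = {u. Poly_Mapping.keys u \<subseteq> UNIV \<times> J1 \<times> J2}"

definition xmon :: "'g \<Rightarrow> nat \<Rightarrow> nat \<Rightarrow> ('g, 'k::zero_neq_one) alg" where
  "xmon \<alpha> i j = Poly_Mapping.single (\<alpha>, i, j) 1"

definition scl :: "'k \<Rightarrow> ('g, 'k) alg \<Rightarrow> ('g::ab_group_add, 'k::field) alg" where
  "scl c u = Poly_Mapping.single 0 c * u"

text \<open>
  For \<open>i = 0\<close> the truncated exponent \<open>i - 1\<close> is harmless, since its coefficient is \<open>0\<close>.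
\<close>

definition der1 ::
    "('g \<Rightarrow> 'k) \<Rightarrow> ('g, 'k) alg \<Rightarrow> ('g::ab_group_add, 'k::field) alg" where
  "der1 \<phi> u = (\<Sum>(\<alpha>, i, j)\<in>Poly_Mapping.keys u. scl (Poly_Mapping.lookup u (\<alpha>, i, j))
     (scl (\<phi> \<alpha>) (xmon \<alpha> i j) + scl (of_nat i) (xmon \<alpha> (i - 1) j)))"

definition der2 ::
    "('g \<Rightarrow> 'k) \<Rightarrow> ('g, 'k) alg \<Rightarrow> ('g::ab_group_add, 'k::field) alg" where
  "der2 \<phi> u = (\<Sum>(\<alpha>, i, j)\<in>Poly_Mapping.keys u. scl (Poly_Mapping.lookup u (\<alpha>, i, j))
     (scl (\<phi> \<alpha>) (xmon \<alpha> i j) + scl (of_nat j) (xmon \<alpha> i (j - 1))))"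

lemma lookup_scl: "Poly_Mapping.lookup (scl c u) k = c * Poly_Mapping.lookup u k"
  by (simp add: scl_def lookup_mult lookup_single when_mult)

lemma xmon_mult:
  "xmon \<alpha> i j * xmon \<beta> k l =
    (xmon (\<alpha> + \<beta>) (i + k) (j + l) :: ('g::ab_group_add, 'k::field) alg)"
  by (simp add: xmon_def mult_single)

lemma der1_xmon:
  "der1 \<phi> (xmon \<alpha> i j) = scl (\<phi> \<alpha>) (xmon \<alpha> i j) + scl (of_nat i) (xmon \<alpha> (i - 1) j)"
  by (simp add: der1_def xmon_def scl_def single_one)

lemma der2_xmon:
  "der2 \<phi> (xmon \<alpha> i j) = scl (\<phi> \<alpha>) (xmon \<alpha> i j) + scl (of_nat j) (xmon \<alpha> i (j - 1))"
  by (simp add: der2_def xmon_def scl_def single_one)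


section \<open>The Lie superalgebras\<close>

definition even_even ::
    "('g \<Rightarrow> 'k) \<Rightarrow> ('g \<Rightarrow> 'k) \<Rightarrow> 'k \<Rightarrow>
     ('g, 'k) alg \<Rightarrow> ('g, 'k) alg \<Rightarrow> ('g::ab_group_add, 'k::field) alg" where
  "even_even \<phi>1 \<phi>2 \<epsilon> u v =
     der1 \<phi>1 u * der2 \<phi>2 v - der1 \<phi>1 v * der2 \<phi>2 u
     + scl \<epsilon> (u * der1 \<phi>1 v - der1 \<phi>1 u * v)"

definition even_odd ::
    "('g \<Rightarrow> 'k) \<Rightarrow> ('g \<Rightarrow> 'k) \<Rightarrow> 'g \<Rightarrow> 'k \<Rightarrow>
     ('g, 'k) alg \<Rightarrow> ('g, 'k) alg \<Rightarrow> ('g::ab_group_add, 'k::field) alg" where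
  "even_odd \<phi>1 \<phi>2 \<alpha>0 \<epsilon> u v =
     der1 \<phi>1 u * der2 \<phi>2 v - der1 \<phi>1 v * der2 \<phi>2 u
     + scl \<epsilon> (u * der1 \<phi>1 v - scl (1 / 2) (der1 \<phi>1 u * v))
     + scl (1 / 2) (scl (\<phi>2 \<alpha>0) (der1 \<phi>1 u * v)
                    + scl (\<phi>1 \<alpha>0) (scl \<epsilon> (u * v) - der2 \<phi>2 u * v))"

text \<open>The bilinear extension of the brackets of homogeneous elements, with \<open>[u, v] = - [v, u]\<close>
  for \<open>u\<close> odd and \<open>v\<close> even.\<close>

definition superbracket ::
    "('g \<Rightarrow> 'k) \<Rightarrow> ('g \<Rightarrow> 'k) \<Rightarrow> 'g \<Rightarrow> 'k \<Rightarrow>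
     ('g, 'k) alg \<times> ('g, 'k) alg \<Rightarrow> ('g, 'k) alg \<times> ('g, 'k) alg \<Rightarrow>
     ('g::ab_group_add, 'k::field) alg \<times> ('g, 'k) alg" where
  "superbracket \<phi>1 \<phi>2 \<alpha>0 \<epsilon> a b =
     (even_even \<phi>1 \<phi>2 \<epsilon> (fst a) (fst b) + xmon \<alpha>0 0 0 * snd a * snd b,
      even_odd \<phi>1 \<phi>2 \<alpha>0 \<epsilon> (fst a) (snd b) - even_odd \<phi>1 \<phi>2 \<alpha>0 \<epsilon> (fst b) (snd a))"

definition A_tilde ::
    "nat set \<Rightarrow> nat set \<Rightarrow> ('g \<Rightarrow> 'k) \<Rightarrow> ('g \<Rightarrow> 'k) \<Rightarrow> 'g \<Rightarrow> 'k \<Rightarrow>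
     ('k, ('g::ab_group_add, 'k::field) alg \<times> ('g, 'k) alg) superalgebra" where
  "A_tilde J1 J2 \<phi>1 \<phi>2 \<alpha>0 \<epsilon> =
     \<lparr>carrier = alg_carrier J1 J2 \<times> alg_carrier J1 J2,
      monoid.mult = superbracket \<phi>1 \<phi>2 \<alpha>0 \<epsilon>, one = 0, zero = 0, add = (+),
      module.smult = (\<lambda>c (u, v). (scl c u, scl c v)),
      grade = (\<lambda>i. if i then {0} \<times> alg_carrier J1 J2 else alg_carrier J1 J2 \<times> {0})\<rparr>"

definition B_tilde_odd ::
    "nat set \<Rightarrow> nat set \<Rightarrow> ('g \<Rightarrow> 'k) \<Rightarrow> ('g \<Rightarrow> 'k) \<Rightarrow> 'g \<Rightarrow> 'k \<Rightarrow>
     (('g::ab_group_add, 'k::field) alg \<times> ('g, 'k) alg) set" where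
  "B_tilde_odd J1 J2 \<phi>1 \<phi>2 \<alpha>0 \<epsilon> = (let A = A_tilde J1 J2 \<phi>1 \<phi>2 \<alpha>0 \<epsilon> in
     lin_span ring_of_type_algebra A
       {a \<otimes>\<^bsub>A\<^esub> b | a b. a \<in> grade A False \<and> b \<in> grade A True})"

definition B_tilde ::
    "nat set \<Rightarrow> nat set \<Rightarrow> ('g \<Rightarrow> 'k) \<Rightarrow> ('g \<Rightarrow> 'k) \<Rightarrow> 'g \<Rightarrow> 'k \<Rightarrow>
     ('k, ('g::ab_group_add, 'k::field) alg \<times> ('g, 'k) alg) superalgebra" where
  "B_tilde J1 J2 \<phi>1 \<phi>2 \<alpha>0 \<epsilon> = (let A = A_tilde J1 J2 \<phi>1 \<phi>2 \<alpha>0 \<epsilon> in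
     A\<lparr>carrier := grade A False <+>\<^bsub>A\<^esub> B_tilde_odd J1 J2 \<phi>1 \<phi>2 \<alpha>0 \<epsilon>,
       grade := (\<lambda>i. if i then B_tilde_odd J1 J2 \<phi>1 \<phi>2 \<alpha>0 \<epsilon> else grade A False)\<rparr>)"

text \<open>
  \<open>x_sigma1\<close> is \<open>x\<^bsup>\<sigma>1,0\<^esup>\<close>, where \<open>\<sigma>1\<close> is the element of the kernel of \<open>\<phi>1\<close> with \<open>\<phi>2 \<sigma>1 = 1\<close>
  (unique when the two kernels intersect trivially), and \<open>0\<close> if there is no such element.
\<close>

definition x_sigma1 :: "('g \<Rightarrow> 'k) \<Rightarrow> ('g \<Rightarrow> 'k) \<Rightarrow> ('g, 'k::field) alg" where
  "x_sigma1 \<phi>1 \<phi>2 =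
     (if \<exists>\<sigma>. \<phi>1 \<sigma> = 0 \<and> \<phi>2 \<sigma> = 1 then xmon (THE \<sigma>. \<phi>1 \<sigma> = 0 \<and> \<phi>2 \<sigma> = 1) 0 0 else 0)"

definition central_elem ::
    "('g \<Rightarrow> 'k) \<Rightarrow> ('g \<Rightarrow> 'k) \<Rightarrow> 'k \<Rightarrow> ('g::ab_group_add, 'k::field) alg \<times> ('g, 'k) alg" where
  "central_elem \<phi>1 \<phi>2 \<epsilon> = (if \<epsilon> = 0 then (xmon 0 0 0, 0) else (x_sigma1 \<phi>1 \<phi>2, 0))"

definition C_tilde ::
    "nat set \<Rightarrow> nat set \<Rightarrow> ('g \<Rightarrow> 'k) \<Rightarrow> ('g \<Rightarrow> 'k) \<Rightarrow> 'g \<Rightarrow> 'k \<Rightarrow>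
     ('k, (('g::ab_group_add, 'k::field) alg \<times> ('g, 'k) alg) set) superalgebra" where
  "C_tilde J1 J2 \<phi>1 \<phi>2 \<alpha>0 \<epsilon> = (let B = B_tilde J1 J2 \<phi>1 \<phi>2 \<alpha>0 \<epsilon> in
     quotient_superalgebra B {c \<odot>\<^bsub>B\<^esub> central_elem \<phi>1 \<phi>2 \<epsilon> | c. True})"

definition kernel_condition :: "('g \<Rightarrow> 'k::zero) \<Rightarrow> ('g \<Rightarrow> 'k) \<Rightarrow> bool" where
  "kernel_condition \<phi>1 \<phi>2 \<longleftrightarrow>
     (\<phi>2 \<noteq> (\<lambda>_. 0) \<longrightarrow> \<not> \<phi>1 -` {0} \<subseteq> \<phi>2 -` {0}) \<and>
     (\<phi>1 \<noteq> (\<lambda>_. 0) \<longrightarrow> \<not> \<phi>2 -` {0} \<subseteq> \<phi>1 -` {0})"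

end

theory Submission
  imports Defs
begin

text \<open>
  Up to the unit \<open>x\<^bsup>\<alpha>0,0\<^esup>\<close> the bracket of two odd elements is the product of the commutative
  algebra \<open>A\<close>. So an ideal of the Lie superalgebra that contains a nonzero odd element \<open>w\<close> contains
  \<open>w v\<close> in its even part for all odd \<open>v\<close>, and the elements that multiply almost all of \<open>A\<close> into the
  even part of the ideal form an associative ideal \<open>M \<noteq> 0\<close> of \<open>A\<close>. Bracketing with odd elements shows
  that \<open>M\<close> is stable under both derivations. As \<open>A\<close> has no proper ideals of this kind, \<open>1 \<in> M\<close>, and from
  this the whole algebra is recovered. An ideal without odd elements is central.

  The odd part of \<open>B\<close> consists of the images of \<open>\<nabla>\<^sub>1\<close> and of \<open>\<nabla>\<^sub>2 - 3/2 \<epsilon>\<close>, where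
  \<open>\<nabla>\<^sub>p = \<partial>\<^sub>p + \<phi>\<^sub>p(\<alpha>0)/2\<close>. It misses at most one monomial, whose weight is annihilated by both operators.
\<close>

section \<open>Derivations of the commutative algebra\<close>

text \<open>The obstacle is the gap in the odd part: products \<open>w * v\<close> are available
  only for \<open>v\<close> in \<open>B1\<close>, where one weight may be missing. Hence an element
  of M may fail on finitely many weights, and this finite set depends on the element, because
  multiplication by a monomial translates it. The gap occurs only if both index sets are
  \<open>{0}\<close>. Then \<open>\<phi>1\<close> is nonzero, the group is infinite, and finitely
  many weights can always be avoided.

  Stability of M under the derivations rests on the form \<open>EO u v = D1 u * (nabla2 v -
  \<epsilon>/2 v) - (D2 u - \<epsilon> u) * nabla1 v\<close>. As \<open>v\<close> runs over the
  monomials of \<open>B1\<close>, the two operators applied to \<open>v\<close> vary enough to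
  isolate \<open>D1 u\<close> and \<open>D2 u - \<epsilon> u\<close> modulo any associative ideal.
  For \<epsilon> = 0 the kernel condition provides this variation; for \<epsilon> = 1 the constant
  \<epsilon>/2 helps. Modulo the zero ideal, the same separation shows that an even element killing
  \<open>B1\<close> is central.\<close>

interpretation alg: vector_space "scl :: 'k::field \<Rightarrow> ('g::ab_group_add, 'k) alg \<Rightarrow> ('g, 'k) alg"
  by unfold_locales
    (simp_all add: scl_def distrib_left distrib_right single_add mult_single flip: mult.assoc)

lemma scl_mult_left: "scl c u * v = scl c (u * v)"
  by (simp add: scl_def mult.assoc)

lemma scl_mult_right: "u * scl c v = scl c (u * v)"
  by (simp add: scl_def mult.left_commute)

lemma xmon_zero: "xmon 0 0 0 = (1 :: ('g::ab_group_add, 'k::field) alg)"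
  by (simp add: xmon_def flip: zero_prod_def)

lemma lookup_xmon:
  "Poly_Mapping.lookup (xmon \<alpha> i j) k = (if k = (\<alpha>, i, j) then 1 else 0)"
  by (simp add: xmon_def lookup_single when_def)

lemma xmon_uminus_mult: "xmon (- \<alpha>) 0 0 * (xmon \<alpha> 0 0 * u) = (u :: ('g::ab_group_add, 'k::field) alg)"
  by (simp add: xmon_mult xmon_zero flip: mult.assoc)

lemma alg_expand: "u = (\<Sum>(\<alpha>, i, j)\<in>Poly_Mapping.keys u. scl (Poly_Mapping.lookup u (\<alpha>, i, j)) (xmon \<alpha> i j))"
proof (rule poly_mapping_eqI)
  fix k
  have "(\<Sum>x\<in>Poly_Mapping.keys u. Poly_Mapping.lookup u x * (if k = x then 1 else 0)) = Poly_Mapping.lookup u k"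
    by (cases "k \<in> Poly_Mapping.keys u") (simp_all add: in_keys_iff if_distrib cong: if_cong)
  then show "Poly_Mapping.lookup u k = Poly_Mapping.lookup
      (\<Sum>(\<alpha>, i, j)\<in>Poly_Mapping.keys u. scl (Poly_Mapping.lookup u (\<alpha>, i, j)) (xmon \<alpha> i j)) k"
    by (simp add: lookup_sum split_def lookup_scl lookup_xmon)
qed

lemma alg_carrier_subset_subspace:
  fixes S :: "('g::ab_group_add, 'k::field) alg set"
  assumes "alg.subspace S"
    and "\<And>\<alpha> i j. i \<in> J1 \<Longrightarrow> j \<in> J2 \<Longrightarrow> xmon \<alpha> i j \<in> S"
  shows "alg_carrier J1 J2 \<subseteq> S"
proof
  fix u :: "('g, 'k) alg" assume "u \<in> alg_carrier J1 J2"
  then have "(\<Sum>(\<alpha>, i, j)\<in>Poly_Mapping.keys u. scl (Poly_Mapping.lookup u (\<alpha>, i, j)) (xmon \<alpha> i j)) \<in> S"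
    using assms by (intro alg.subspace_sum) (auto simp: alg_carrier_def alg.subspace_def)
  then show "u \<in> S"
    using alg_expand[of u] by simp
qed

text \<open>The closure rules make the elements satisfying \<open>P\<close> a subspace that contains
  all monomials; with both index sets \<open>UNIV\<close> the carrier is the whole type.\<close>

lemma alg_induct [case_names zero mon add scl]:
  fixes u :: "('g::ab_group_add, 'k::field) alg"
  assumes "P 0" "\<And>\<alpha> i j. P (xmon \<alpha> i j)" "\<And>u v. P u \<Longrightarrow> P v \<Longrightarrow> P (u + v)" "\<And>c u. P u \<Longrightarrow> P (scl c u)"
  shows "P u"
proof -
  have "alg_carrier UNIV UNIV \<subseteq> {u. P u}"
    using assms by (intro alg_carrier_subset_subspace) (auto simp: alg.subspace_def)
  then show ?thesis
    by (auto simp: alg_carrier_def)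
qed

text \<open>Seen from the target key, the truncated \<open>i - 1\<close> becomes
  \<open>Suc i\<close>: a coefficient receives only from its own key and from the next one.
  Linearity and commutation of the derivations then become identities of coefficients.\<close>

lemma lookup_der1:
  "Poly_Mapping.lookup (der1 \<phi> u) (\<alpha>, i, j) =
    \<phi> \<alpha> * Poly_Mapping.lookup u (\<alpha>, i, j) + of_nat (Suc i) * Poly_Mapping.lookup u (\<alpha>, Suc i, j)"
proof -
  have "Poly_Mapping.lookup (der1 \<phi> u) (\<alpha>, i, j) =
      (\<Sum>k\<in>Poly_Mapping.keys u. (if (\<alpha>, i, j) = k then \<phi> \<alpha> * Poly_Mapping.lookup u (\<alpha>, i, j) else 0)
        + (if (\<alpha>, Suc i, j) = k then of_nat (Suc i) * Poly_Mapping.lookup u (\<alpha>, Suc i, j) else 0))"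
    unfolding der1_def lookup_sum
  proof (rule sum.cong[OF refl], goal_cases)
    case (1 k)
    obtain b c d where "k = (b, c, d)"
      by (cases k)
    then show ?case
      \<comment> \<open>For \<open>c = 0\<close> truncation sends the key to itself, but the factor
        \<open>of_nat 0\<close> removes the term.\<close>
      by (cases c) (auto simp: lookup_scl lookup_add lookup_xmon algebra_simps)
  qed
  then show ?thesis
    by (simp add: sum.distrib in_keys_iff)
qed

lemma lookup_der2:
  "Poly_Mapping.lookup (der2 \<phi> u) (\<alpha>, i, j) =
    \<phi> \<alpha> * Poly_Mapping.lookup u (\<alpha>, i, j) + of_nat (Suc j) * Poly_Mapping.lookup u (\<alpha>, i, Suc j)"
proof -
  have "Poly_Mapping.lookup (der2 \<phi> u) (\<alpha>, i, j) =
      (\<Sum>k\<in>Poly_Mapping.keys u. (if (\<alpha>, i, j) = k then \<phi> \<alpha> * Poly_Mapping.lookup u (\<alpha>, i, j) else 0)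
        + (if (\<alpha>, i, Suc j) = k then of_nat (Suc j) * Poly_Mapping.lookup u (\<alpha>, i, Suc j) else 0))"
    unfolding der2_def lookup_sum
  proof (rule sum.cong[OF refl], goal_cases)
    case (1 k)
    obtain b c d where "k = (b, c, d)"
      by (cases k)
    then show ?case
      by (cases d) (auto simp: lookup_scl lookup_add lookup_xmon algebra_simps)
  qed
  then show ?thesis
    by (simp add: sum.distrib in_keys_iff)
qed

lemma der1_add: "der1 \<phi> (u + v) = der1 \<phi> u + der1 \<phi> v"
  by (rule poly_mapping_eqI) (auto simp: lookup_der1 lookup_add algebra_simps)

lemma der2_add: "der2 \<phi> (u + v) = der2 \<phi> u + der2 \<phi> v"
  by (rule poly_mapping_eqI) (auto simp: lookup_der2 lookup_add algebra_simps)

lemma der1_scl: "der1 \<phi> (scl c u) = scl c (der1 \<phi> u)"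
  by (rule poly_mapping_eqI) (auto simp: lookup_der1 lookup_scl algebra_simps)

lemma der2_scl: "der2 \<phi> (scl c u) = scl c (der2 \<phi> u)"
  by (rule poly_mapping_eqI) (auto simp: lookup_der2 lookup_scl algebra_simps)

lemma der1_zero [simp]: "der1 \<phi> 0 = 0"
  by (simp add: der1_def)

lemma der2_zero [simp]: "der2 \<phi> 0 = 0"
  by (simp add: der2_def)

lemma der1_diff: "der1 \<phi> (u - v) = der1 \<phi> u - der1 \<phi> v"
  by (rule poly_mapping_eqI) (auto simp: lookup_der1 lookup_minus algebra_simps)

lemma der2_diff: "der2 \<phi> (u - v) = der2 \<phi> u - der2 \<phi> v"
  by (rule poly_mapping_eqI) (auto simp: lookup_der2 lookup_minus algebra_simps)

lemma der1_der2_commute: "der1 \<phi> (der2 \<psi> u) = der2 \<psi> (der1 \<phi> u)"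
  by (rule poly_mapping_eqI) (auto simp: lookup_der1 lookup_der2 algebra_simps)

lemma der1_mult:
  assumes "additive \<phi>"
  shows "der1 \<phi> (u * v) = der1 \<phi> u * v + u * der1 \<phi> v"
proof (induction u rule: alg_induct)
  case (mon \<alpha> i j)
  show ?case
  proof (induction v rule: alg_induct)
    case (mon \<beta> k l)
    \<comment> \<open>Both Leibniz terms have to land on the same monomial. Truncated subtraction
      spoils this only at exponent 0, where the coefficient vanishes.\<close>
    have "xmon (\<alpha> + \<beta>) (i - 1 + k) (j + l) = (xmon (\<alpha> + \<beta>) (i + k - 1) (j + l) :: ('a, 'b) alg)" if "i > 0"
      using that by simp
    moreover have "xmon (\<alpha> + \<beta>) (i + (k - 1)) (j + l) = (xmon (\<alpha> + \<beta>) (i + k - 1) (j + l) :: ('a, 'b) alg)" if "k > 0"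
      using that by simp
    ultimately show ?case
      by (cases "i = 0"; cases "k = 0")
        (simp_all add: der1_xmon xmon_mult distrib_left distrib_right scl_mult_left scl_mult_right
          additive.add[OF assms] alg.scale_left_distrib)
  qed (simp_all add: distrib_left der1_add der1_scl scl_mult_right alg.scale_right_distrib)
qed (simp_all add: distrib_right der1_add der1_scl scl_mult_left alg.scale_right_distrib)

lemma der2_mult:
  assumes "additive \<phi>"
  shows "der2 \<phi> (u * v) = der2 \<phi> u * v + u * der2 \<phi> v"
proof (induction u rule: alg_induct)
  case (mon \<alpha> i j)
  show ?case
  proof (induction v rule: alg_induct)
    case (mon \<beta> k l)
    have "xmon (\<alpha> + \<beta>) (i + k) (j - 1 + l) = (xmon (\<alpha> + \<beta>) (i + k) (j + l - 1) :: ('a, 'b) alg)" if "j > 0"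
      using that by simp
    moreover have "xmon (\<alpha> + \<beta>) (i + k) (j + (l - 1)) = (xmon (\<alpha> + \<beta>) (i + k) (j + l - 1) :: ('a, 'b) alg)" if "l > 0"
      using that by simp
    ultimately show ?case
      by (cases "j = 0"; cases "l = 0")
        (simp_all add: der2_xmon xmon_mult distrib_left distrib_right scl_mult_left scl_mult_right
          additive.add[OF assms] alg.scale_left_distrib)
  qed (simp_all add: distrib_left der2_add der2_scl scl_mult_right alg.scale_right_distrib)
qed (simp_all add: distrib_right der2_add der2_scl scl_mult_left alg.scale_right_distrib)

section \<open>Closure of the carrier under products and derivations\<close>

lemma subspace_alg_carrier: "alg.subspace (alg_carrier J1 J2)"
  unfolding alg.subspace_def alg_carrier_def
  by (auto simp: subset_iff in_keys_iff lookup_add lookup_scl) (metis add.right_neutral)+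

lemma xmon_carrier: "i \<in> J1 \<Longrightarrow> j \<in> J2 \<Longrightarrow> xmon \<alpha> i j \<in> alg_carrier J1 J2"
  by (simp add: alg_carrier_def xmon_def)

lemma mult_carrier:
  assumes "J1 \<in> {{0}, UNIV}" "J2 \<in> {{0}, UNIV}"
    and "u \<in> alg_carrier J1 J2" "v \<in> alg_carrier J1 J2"
  shows "u * v \<in> alg_carrier J1 J2"
proof -
  have "k \<in> UNIV \<times> J1 \<times> J2" if "k \<in> Poly_Mapping.keys (u * v)" for k
  proof -
    obtain a b where "k = a + b" "a \<in> Poly_Mapping.keys u" "b \<in> Poly_Mapping.keys v"
      using \<open>k \<in> Poly_Mapping.keys (u * v)\<close> keys_mult[of u v] by blast
    with assms show ?thesis
      unfolding alg_carrier_def by (cases a; cases b) auto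
  qed
  then show ?thesis
    by (auto simp: alg_carrier_def)
qed

lemma der1_carrier:
  assumes "J1 \<in> {{0}, UNIV}" "u \<in> alg_carrier J1 J2"
  shows "der1 \<phi> u \<in> alg_carrier J1 J2"
proof -
  have "(\<alpha>, i, j) \<in> UNIV \<times> J1 \<times> J2" if "(\<alpha>, i, j) \<in> Poly_Mapping.keys (der1 \<phi> u)" for \<alpha> i j
  proof -
    have "(\<alpha>, i, j) \<in> Poly_Mapping.keys u \<or> (\<alpha>, Suc i, j) \<in> Poly_Mapping.keys u"
      using that by (auto simp: lookup_der1 in_keys_iff)
    with assms show ?thesis
      unfolding alg_carrier_def by blast
  qed
  then show ?thesis
    unfolding alg_carrier_def by auto
qed

lemma der2_carrier:
  assumes "J2 \<in> {{0}, UNIV}" "u \<in> alg_carrier J1 J2"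
  shows "der2 \<phi> u \<in> alg_carrier J1 J2"
proof -
  have "(\<alpha>, i, j) \<in> UNIV \<times> J1 \<times> J2" if "(\<alpha>, i, j) \<in> Poly_Mapping.keys (der2 \<phi> u)" for \<alpha> i j
  proof -
    have "(\<alpha>, i, j) \<in> Poly_Mapping.keys u \<or> (\<alpha>, i, Suc j) \<in> Poly_Mapping.keys u"
      using that by (auto simp: lookup_der2 in_keys_iff)
    with assms show ?thesis
      unfolding alg_carrier_def by blast
  qed
  then show ?thesis
    unfolding alg_carrier_def by auto
qed

section \<open>Quotients of Lie superalgebras\<close>

text \<open>The linear part of the quotient construction, isolated because it serves both the
  central quotient and the codimension.\<close>

locale quotient_module = Module.module K L + submodule N K L
  for K :: "('k, 'm) ring_scheme" and L :: "('k, 'v, 'n) superalgebra_scheme" and N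
begin

sublocale N: abelian_subgroup N L
  by (intro abelian_subgroupI3 additive_subgroup.intro) unfold_locales

abbreviation cls :: "'v \<Rightarrow> 'v set" where "cls x \<equiv> N +>\<^bsub>L\<^esub> x"

lemma cls_eqI:
  assumes "x \<in> carrier L" "y \<in> carrier L" "h \<in> N" "y = h \<oplus>\<^bsub>L\<^esub> x"
  shows "cls y = cls x"
  using assms N.a_subgroup N.a_subset
  by (metis M.a_repr_independence M.a_rcosI)

lemma cls_eqD:
  assumes "cls y = cls x" "x \<in> carrier L" "y \<in> carrier L"
  obtains h where "h \<in> N" "y = h \<oplus>\<^bsub>L\<^esub> x"
proof -
  have "y \<in> cls x"
    using assms N.a_rcos_self[of y] by simp
  then show ?thesis
    using that by (auto simp: a_r_coset_def')
qed

lemma cls_in: "h \<in> N \<Longrightarrow> cls h = N"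
  using N.a_subgroup N.a_subset by (simp add: M.a_coset_join2 subset_iff)

lemma cls_eq_self_iff: "x \<in> carrier L \<Longrightarrow> cls x = N \<longleftrightarrow> x \<in> N"
  using N.a_rcos_self cls_in by blast

lemma carrier_quotient: "carrier (quotient_superalgebra L N) = cls ` carrier L"
  by (auto simp: quotient_superalgebra_def A_RCOSETS_def')

lemma zero_quotient: "\<zero>\<^bsub>quotient_superalgebra L N\<^esub> = N"
  by (simp add: quotient_superalgebra_def)

lemma add_quotient:
  assumes "x \<in> carrier L" "y \<in> carrier L"
  shows "cls x \<oplus>\<^bsub>quotient_superalgebra L N\<^esub> cls y = cls (x \<oplus>\<^bsub>L\<^esub> y)"
  using N.a_rcos_sum[OF assms] by (simp add: quotient_superalgebra_def)

text \<open>The scalar multiple of a coset is a union over all representatives; these contribute the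
  same coset because \<open>N\<close> absorbs scalars.\<close>

lemma smult_quotient:
  assumes "c \<in> carrier K" "x \<in> carrier L"
  shows "c \<odot>\<^bsub>quotient_superalgebra L N\<^esub> cls x = cls (c \<odot>\<^bsub>L\<^esub> x)"
proof -
  have "cls (c \<odot>\<^bsub>L\<^esub> y) = cls (c \<odot>\<^bsub>L\<^esub> x)" if y: "y \<in> cls x" for y
  proof -
    obtain h where h: "h \<in> N" "y = h \<oplus>\<^bsub>L\<^esub> x"
      using y by (auto simp: a_r_coset_def')
    with assms N.a_subset have "c \<odot>\<^bsub>L\<^esub> y = (c \<odot>\<^bsub>L\<^esub> h) \<oplus>\<^bsub>L\<^esub> (c \<odot>\<^bsub>L\<^esub> x)"
      by (auto simp: smult_r_distr)
    with h assms N.a_subset show ?thesis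
      by (intro cls_eqI[where h = "c \<odot>\<^bsub>L\<^esub> h"]) auto
  qed
  moreover have "x \<in> cls x"
    using assms by (simp add: N.a_rcos_self)
  ultimately have "(\<Union>y\<in>cls x. cls (c \<odot>\<^bsub>L\<^esub> y)) = cls (c \<odot>\<^bsub>L\<^esub> x)"
    by blast
  then show ?thesis
    by (simp add: quotient_superalgebra_def)
qed

lemmas quotient_simps = carrier_quotient zero_quotient add_quotient smult_quotient

lemma abelian_group_quotient: "abelian_group (quotient_superalgebra L N)"
proof (rule abelian_groupI)
  have z: "cls \<zero>\<^bsub>L\<^esub> = N"
    by (simp add: cls_in)
  show "\<zero>\<^bsub>quotient_superalgebra L N\<^esub> \<in> carrier (quotient_superalgebra L N)"
    unfolding zero_quotient carrier_quotient using z by blast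
  fix S assume "S \<in> carrier (quotient_superalgebra L N)"
  then obtain x where x: "S = cls x" "x \<in> carrier L"
    unfolding carrier_quotient by blast
  show "\<exists>T\<in>carrier (quotient_superalgebra L N).
      T \<oplus>\<^bsub>quotient_superalgebra L N\<^esub> S = \<zero>\<^bsub>quotient_superalgebra L N\<^esub>"
    using x z by (intro bexI[of _ "cls (\<ominus>\<^bsub>L\<^esub> x)"]) (simp_all add: quotient_simps M.l_neg)
  show "\<zero>\<^bsub>quotient_superalgebra L N\<^esub> \<oplus>\<^bsub>quotient_superalgebra L N\<^esub> S = S"
    using x add_quotient[of "\<zero>\<^bsub>L\<^esub>" x] unfolding z zero_quotient by simp
  fix T assume "T \<in> carrier (quotient_superalgebra L N)"
  then obtain y where y: "T = cls y" "y \<in> carrier L"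
    unfolding carrier_quotient by blast
  show "S \<oplus>\<^bsub>quotient_superalgebra L N\<^esub> T \<in> carrier (quotient_superalgebra L N)"
    using x y by (simp add: quotient_simps)
  show "S \<oplus>\<^bsub>quotient_superalgebra L N\<^esub> T = T \<oplus>\<^bsub>quotient_superalgebra L N\<^esub> S"
    using x y by (simp add: quotient_simps M.a_comm)
  fix U assume "U \<in> carrier (quotient_superalgebra L N)"
  then obtain w where "U = cls w" "w \<in> carrier L"
    unfolding carrier_quotient by blast
  then show "S \<oplus>\<^bsub>quotient_superalgebra L N\<^esub> T \<oplus>\<^bsub>quotient_superalgebra L N\<^esub> U =
      S \<oplus>\<^bsub>quotient_superalgebra L N\<^esub> (T \<oplus>\<^bsub>quotient_superalgebra L N\<^esub> U)"
    using x y by (simp add: quotient_simps M.a_assoc)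
qed

lemma module_quotient: "Module.module K (quotient_superalgebra L N)"
proof (rule moduleI[OF R.is_cring abelian_group_quotient])
  fix a S assume a: "a \<in> carrier K" and "S \<in> carrier (quotient_superalgebra L N)"
  then obtain x where x: "S = cls x" "x \<in> carrier L"
    unfolding carrier_quotient by blast
  show "a \<odot>\<^bsub>quotient_superalgebra L N\<^esub> S \<in> carrier (quotient_superalgebra L N)"
    using x a by (simp add: quotient_simps)
  fix b assume b: "b \<in> carrier K"
  show "(a \<oplus>\<^bsub>K\<^esub> b) \<odot>\<^bsub>quotient_superalgebra L N\<^esub> S =
      a \<odot>\<^bsub>quotient_superalgebra L N\<^esub> S \<oplus>\<^bsub>quotient_superalgebra L N\<^esub> b \<odot>\<^bsub>quotient_superalgebra L N\<^esub> S"
    using x a b by (simp add: quotient_simps smult_l_distr)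
  show "a \<otimes>\<^bsub>K\<^esub> b \<odot>\<^bsub>quotient_superalgebra L N\<^esub> S =
      a \<odot>\<^bsub>quotient_superalgebra L N\<^esub> (b \<odot>\<^bsub>quotient_superalgebra L N\<^esub> S)"
    using x a b by (simp add: quotient_simps smult_assoc1)
next
  fix a S T assume a: "a \<in> carrier K" and "S \<in> carrier (quotient_superalgebra L N)"
    "T \<in> carrier (quotient_superalgebra L N)"
  then obtain x y where "S = cls x" "x \<in> carrier L" "T = cls y" "y \<in> carrier L"
    unfolding carrier_quotient by blast
  with a show "a \<odot>\<^bsub>quotient_superalgebra L N\<^esub> (S \<oplus>\<^bsub>quotient_superalgebra L N\<^esub> T) =
      a \<odot>\<^bsub>quotient_superalgebra L N\<^esub> S \<oplus>\<^bsub>quotient_superalgebra L N\<^esub> a \<odot>\<^bsub>quotient_superalgebra L N\<^esub> T"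
    by (simp add: quotient_simps smult_r_distr)
next
  fix S assume "S \<in> carrier (quotient_superalgebra L N)"
  then obtain x where "S = cls x" "x \<in> carrier L"
    unfolding carrier_quotient by blast
  then show "\<one>\<^bsub>K\<^esub> \<odot>\<^bsub>quotient_superalgebra L N\<^esub> S = S"
    by (simp add: quotient_simps)
qed

lemma minus_quotient:
  assumes "x \<in> carrier L"
  shows "\<ominus>\<^bsub>quotient_superalgebra L N\<^esub> cls x = cls (\<ominus>\<^bsub>L\<^esub> x)"
proof -
  interpret Q: Module.module K "quotient_superalgebra L N"
    by (rule module_quotient)
  show ?thesis
    using assms by (intro Q.minus_equality) (auto simp: quotient_simps M.l_neg cls_in)
qed

lemma image_submodule_quotient:
  assumes "submodule H K L"
  shows "submodule (cls ` H) K (quotient_superalgebra L N)"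
proof -
  interpret Q: Module.module K "quotient_superalgebra L N"
    by (rule module_quotient)
  have H: "H \<subseteq> carrier L"
    using submoduleE[OF assms] by simp
  have "\<zero>\<^bsub>L\<^esub> \<in> H"
    using subgroup.one_closed[OF submodule.axioms(1)[OF assms]] by simp
  moreover have "N = cls \<zero>\<^bsub>L\<^esub>"
    by (simp add: cls_in)
  ultimately have "N \<in> cls ` H"
    by blast
  then show ?thesis
    using H submoduleE[OF assms]
    by (intro Q.submoduleI) (auto simp: quotient_simps minus_quotient subset_iff)
qed

end

section \<open>Quotient by a graded ideal\<close>

locale quotient_lie_superalgebra = lie_superalgebra K L
  for K :: "('k, 'm) ring_scheme" and L :: "('k, 'v, 'n) superalgebra_scheme" +
  fixes N
  assumes graded_ideal: "graded_ideal K N L"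
begin

sublocale quotient_module K L N
  using graded_ideal unfolding graded_ideal_def
  by (intro quotient_module.intro) (blast intro: module_axioms)+

lemma ideal_left: "a \<in> carrier L \<Longrightarrow> x \<in> N \<Longrightarrow> a \<otimes>\<^bsub>L\<^esub> x \<in> N"
  and ideal_right: "a \<in> carrier L \<Longrightarrow> x \<in> N \<Longrightarrow> x \<otimes>\<^bsub>L\<^esub> a \<in> N"
  using graded_ideal unfolding graded_ideal_def by blast+

text \<open>For representatives \<open>h + x\<close> and \<open>k + y\<close> the product changes by
  \<open>[h, k + y] + [x, k]\<close>, which a two-sided ideal contains.\<close>

lemma mult_quotient:
  assumes "x \<in> carrier L" "y \<in> carrier L"
  shows "cls x \<otimes>\<^bsub>quotient_superalgebra L N\<^esub> cls y = cls (x \<otimes>\<^bsub>L\<^esub> y)"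
proof -
  have "cls (a \<otimes>\<^bsub>L\<^esub> b) = cls (x \<otimes>\<^bsub>L\<^esub> y)" if ab: "a \<in> cls x" "b \<in> cls y" for a b
  proof -
    obtain h k where h: "h \<in> N" "a = h \<oplus>\<^bsub>L\<^esub> x" and k: "k \<in> N" "b = k \<oplus>\<^bsub>L\<^esub> y"
      using ab by (auto simp: a_r_coset_def')
    have hk: "h \<in> carrier L" "k \<in> carrier L"
      using h k N.a_subset by auto
    have b: "b \<in> carrier L"
      using k(2) hk assms by simp
    have "a \<otimes>\<^bsub>L\<^esub> b = (h \<otimes>\<^bsub>L\<^esub> b) \<oplus>\<^bsub>L\<^esub> (x \<otimes>\<^bsub>L\<^esub> b)"
      using hk assms b by (simp only: h(2) bracket_add_left)
    also have "x \<otimes>\<^bsub>L\<^esub> b = (x \<otimes>\<^bsub>L\<^esub> k) \<oplus>\<^bsub>L\<^esub> (x \<otimes>\<^bsub>L\<^esub> y)"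
      using hk assms by (simp only: k(2) bracket_add_right)
    also have "(h \<otimes>\<^bsub>L\<^esub> b) \<oplus>\<^bsub>L\<^esub> \<dots> = ((h \<otimes>\<^bsub>L\<^esub> b) \<oplus>\<^bsub>L\<^esub> (x \<otimes>\<^bsub>L\<^esub> k)) \<oplus>\<^bsub>L\<^esub> (x \<otimes>\<^bsub>L\<^esub> y)"
      using hk assms b by (simp only: M.a_assoc bracket_closed)
    finally have "a \<otimes>\<^bsub>L\<^esub> b = ((h \<otimes>\<^bsub>L\<^esub> b) \<oplus>\<^bsub>L\<^esub> (x \<otimes>\<^bsub>L\<^esub> k)) \<oplus>\<^bsub>L\<^esub> (x \<otimes>\<^bsub>L\<^esub> y)" .
    moreover have "(h \<otimes>\<^bsub>L\<^esub> b) \<oplus>\<^bsub>L\<^esub> (x \<otimes>\<^bsub>L\<^esub> k) \<in> N"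
      using h k b assms by (intro N.a_closed ideal_left ideal_right)
    moreover have "a \<otimes>\<^bsub>L\<^esub> b \<in> carrier L" "x \<otimes>\<^bsub>L\<^esub> y \<in> carrier L"
      using h(2) hk b assms by (simp_all add: bracket_closed)
    ultimately show ?thesis
      by (intro cls_eqI)
  qed
  moreover have "x \<in> cls x" "y \<in> cls y"
    using assms by (simp_all add: N.a_rcos_self)
  ultimately have "(\<Union>a\<in>cls x. \<Union>b\<in>cls y. cls (a \<otimes>\<^bsub>L\<^esub> b)) = cls (x \<otimes>\<^bsub>L\<^esub> y)"
    by blast
  then show ?thesis
    by (simp add: quotient_superalgebra_def rcoset_mult_def)
qed

lemma grade_quotient: "grade (quotient_superalgebra L N) i = cls ` grade L i"
  by (simp add: quotient_superalgebra_def)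

lemma grade_carrier: "x \<in> grade L i \<Longrightarrow> x \<in> carrier L"
  using submoduleE(1)[OF grade_submodule] by auto

lemma grade_sum_quotient:
  "carrier (quotient_superalgebra L N) = grade (quotient_superalgebra L N) False
    <+>\<^bsub>quotient_superalgebra L N\<^esub> grade (quotient_superalgebra L N) True"
proof -
  have "carrier (quotient_superalgebra L N) = cls ` (grade L False <+>\<^bsub>L\<^esub> grade L True)"
    by (simp only: carrier_quotient flip: grade_sum)
  also have "\<dots> = {cls (x \<oplus>\<^bsub>L\<^esub> y) |x y. x \<in> grade L False \<and> y \<in> grade L True}"
    by (auto simp: set_add_def')
  also have "\<dots> = {cls x \<oplus>\<^bsub>quotient_superalgebra L N\<^esub> cls y |x y. x \<in> grade L False \<and> y \<in> grade L True}"
    by (metis (no_types, opaque_lifting) add_quotient grade_carrier)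
  also have "\<dots> = grade (quotient_superalgebra L N) False
      <+>\<^bsub>quotient_superalgebra L N\<^esub> grade (quotient_superalgebra L N) True"
    by (auto simp: set_add_def' grade_quotient)
  finally show ?thesis .
qed

text \<open>Gradedness of \<open>N\<close> is essential: if \<open>x\<close> even and
  \<open>y\<close> odd differ by \<open>h = h0 + h1\<close> in \<open>N\<close>, then
  \<open>x - h0 = h1 + y\<close> is both even and odd, hence 0, and \<open>x = h0\<close> lies in
  \<open>N\<close>.\<close>

lemma grade_inter_quotient:
  "grade (quotient_superalgebra L N) False \<inter> grade (quotient_superalgebra L N) True = {N}"
proof
  show "grade (quotient_superalgebra L N) False \<inter> grade (quotient_superalgebra L N) True \<subseteq> {N}"
  proof
    fix S assume "S \<in> grade (quotient_superalgebra L N) False \<inter> grade (quotient_superalgebra L N) True"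
    then obtain x y where x: "x \<in> grade L False" "S = cls x" and y: "y \<in> grade L True" "S = cls y"
      by (auto simp: grade_quotient)
    obtain h where h: "h \<in> N" "x = h \<oplus>\<^bsub>L\<^esub> y"
      using x y cls_eqD by (metis grade_carrier)
    have "N = (N \<inter> grade L False) <+>\<^bsub>L\<^esub> (N \<inter> grade L True)"
      using graded_ideal unfolding graded_ideal_def by blast
    with h(1) obtain h0 h1 where h01: "h0 \<in> N" "h0 \<in> grade L False" "h1 \<in> N" "h1 \<in> grade L True"
        "h = h0 \<oplus>\<^bsub>L\<^esub> h1"
      unfolding set_add_def' by blast
    note c = grade_carrier[OF x(1)] grade_carrier[OF y(1)] grade_carrier[OF h01(2)] grade_carrier[OF h01(4)]
    have "\<ominus>\<^bsub>L\<^esub> h0 \<oplus>\<^bsub>L\<^esub> x = h1 \<oplus>\<^bsub>L\<^esub> y"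
      unfolding h(2) h01(5) using c by (simp add: M.a_assoc M.r_neg1)
    moreover have "\<ominus>\<^bsub>L\<^esub> h0 \<oplus>\<^bsub>L\<^esub> x \<in> grade L False"
      using x h01 submoduleE[OF grade_submodule] by blast
    moreover have "h1 \<oplus>\<^bsub>L\<^esub> y \<in> grade L True"
      using y h01 submoduleE[OF grade_submodule] by blast
    ultimately have "\<ominus>\<^bsub>L\<^esub> h0 \<oplus>\<^bsub>L\<^esub> x = \<zero>\<^bsub>L\<^esub>"
      using grade_inter by auto
    then have "h0 \<oplus>\<^bsub>L\<^esub> (\<ominus>\<^bsub>L\<^esub> h0 \<oplus>\<^bsub>L\<^esub> x) = h0"
      using c by simp
    then have "x = h0"
      using c by (simp add: M.r_neg2)
    then show "S \<in> {N}"
      using x h01 cls_in by simp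
  qed
  have "\<zero>\<^bsub>L\<^esub> \<in> grade L i" for i
    using subgroup.one_closed[OF submodule.axioms(1)[OF grade_submodule]] by simp
  then show "{N} \<subseteq> grade (quotient_superalgebra L N) False \<inter> grade (quotient_superalgebra L N) True"
    using cls_in[OF N.zero_closed] unfolding grade_quotient by blast
qed

lemma lie_superalgebra_quotient: "lie_superalgebra K (quotient_superalgebra L N)"
proof (intro lie_superalgebra.intro lie_superalgebra_axioms.intro, goal_cases)
  case 1
  show ?case by (rule field_axioms)
next
  case 2
  show ?case by (rule module_quotient)
next
  case (3 i)
  show ?case
    unfolding grade_quotient by (rule image_submodule_quotient[OF grade_submodule])
next
  case 4
  show ?case by (rule grade_sum_quotient)
next
  case 5
  show ?case by (simp only: grade_inter_quotient zero_quotient)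
next
  case (11 x i y j)
  then obtain a b where ab: "x = cls a" "a \<in> grade L i" "y = cls b" "b \<in> grade L j"
    unfolding grade_quotient by blast
  then have "x \<otimes>\<^bsub>quotient_superalgebra L N\<^esub> y = cls (a \<otimes>\<^bsub>L\<^esub> b)"
    by (simp add: grade_carrier mult_quotient)
  then show ?case
    unfolding grade_quotient using bracket_grade[OF ab(2,4)] by blast
next
  case (12 x i y j)
  then obtain a b where "x = cls a" "a \<in> grade L i" "y = cls b" "b \<in> grade L j"
    by (auto simp: grade_quotient)
  then show ?case
    using super_skew[of a i b j] by (simp add: grade_carrier mult_quotient minus_quotient bracket_closed)
next
  case (13 x i y j z k)
  then obtain a b c where "x = cls a" "a \<in> grade L i" "y = cls b" "b \<in> grade L j" "z = cls c" "c \<in> grade L k"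
    by (auto simp: grade_quotient)
  then show ?case
    using super_jacobi[of a i b j c k]
    by (simp add: grade_carrier mult_quotient minus_quotient add_quotient bracket_closed)
qed (auto simp: quotient_simps mult_quotient bracket_closed bracket_add_left bracket_add_right
      bracket_smult_left bracket_smult_right)

end

section \<open>The brackets\<close>

locale contact_bracket =
  fixes \<phi>1 \<phi>2 :: "'g::ab_group_add \<Rightarrow> 'k::field_char_0"
    and \<alpha>0 :: 'g and \<epsilon> :: 'k and J1 J2 :: "nat set"
  assumes \<phi>1: "additive \<phi>1" and \<phi>2: "additive \<phi>2"
    and J1: "J1 \<in> {{0}, UNIV}" and J2: "J2 \<in> {{0}, UNIV}"
begin

abbreviation "D1 \<equiv> der1 \<phi>1"
abbreviation "D2 \<equiv> der2 \<phi>2"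
abbreviation "A \<equiv> (alg_carrier J1 J2 :: ('g, 'k) alg set)"
abbreviation "EE \<equiv> even_even \<phi>1 \<phi>2 \<epsilon>"
abbreviation "EO \<equiv> even_odd \<phi>1 \<phi>2 \<alpha>0 \<epsilon>"
abbreviation t :: "('g, 'k) alg" where "t \<equiv> xmon \<alpha>0 0 0"

text \<open>The derivations conjugated by a formal square root of \<open>t\<close>: odd elements behave as
  multiples of that root.\<close>

definition nabla1 :: "('g, 'k) alg \<Rightarrow> ('g, 'k) alg" where
  "nabla1 v = D1 v + scl (\<phi>1 \<alpha>0 / 2) v"

definition nabla2 :: "('g, 'k) alg \<Rightarrow> ('g, 'k) alg" where
  "nabla2 v = D2 v + scl (\<phi>2 \<alpha>0 / 2) v"

lemma D_linear:
  "D1 (u + v) = D1 u + D1 v" "D2 (u + v) = D2 u + D2 v"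
  "D1 (u - v) = D1 u - D1 v" "D2 (u - v) = D2 u - D2 v"
  "D1 (scl c u) = scl c (D1 u)" "D2 (scl c u) = scl c (D2 u)"
  by (simp_all add: der1_add der2_add der1_diff der2_diff der1_scl der2_scl)

lemma D_mult: "D1 (u * v) = D1 u * v + u * D1 v" "D2 (u * v) = D2 u * v + u * D2 v"
  by (simp_all add: der1_mult[OF \<phi>1] der2_mult[OF \<phi>2])

lemma nabla_linear:
  "nabla1 (u + v) = nabla1 u + nabla1 v" "nabla2 (u + v) = nabla2 u + nabla2 v"
  "nabla1 (u - v) = nabla1 u - nabla1 v" "nabla2 (u - v) = nabla2 u - nabla2 v"
  "nabla1 (scl c u) = scl c (nabla1 u)" "nabla2 (scl c u) = scl c (nabla2 u)"
  unfolding nabla1_def nabla2_def D_linear by (simp_all add: scl_def algebra_simps)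

lemma nabla_mult:
  "nabla1 (u * v) = D1 u * v + u * nabla1 v" "nabla2 (u * v) = D2 u * v + u * nabla2 v"
  by (simp_all add: nabla1_def nabla2_def D_mult scl_def algebra_simps)

lemma nabla_commute: "nabla1 (nabla2 v) = nabla2 (nabla1 v)"
  unfolding nabla1_def nabla2_def D_linear der1_der2_commute by (simp add: scl_def algebra_simps)

lemma D_t: "D1 t = scl (\<phi>1 \<alpha>0) t" "D2 t = scl (\<phi>2 \<alpha>0) t"
  by (simp_all add: der1_xmon der2_xmon)

text \<open>With a formal root s of \<open>t\<close>, the product \<open>t * v * w\<close> is (s
  v)(s w) and a derivation maps s v to s times its nabla, so this is the Leibniz rule. The proof
  splits the eigenvalue of \<open>t\<close> evenly between \<open>v\<close> and
  \<open>w\<close>.\<close>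

lemma nabla_t:
  "D1 (t * v * w) = t * (nabla1 v * w + v * nabla1 w)"
  "D2 (t * v * w) = t * (nabla2 v * w + v * nabla2 w)"
proof -
  have half: "scl c u = scl (c / 2) u + scl (c / 2) u" for c and u :: "('g, 'k) alg"
    by (simp flip: alg.scale_left_distrib)
  have "scl (\<phi>1 \<alpha>0) t * v * w = t * (scl (\<phi>1 \<alpha>0 / 2) v * w + v * scl (\<phi>1 \<alpha>0 / 2) w)"
    by (subst half) (simp add: scl_def algebra_simps)
  then show "D1 (t * v * w) = t * (nabla1 v * w + v * nabla1 w)"
    by (simp add: D_mult D_t nabla1_def algebra_simps)
  have "scl (\<phi>2 \<alpha>0) t * v * w = t * (scl (\<phi>2 \<alpha>0 / 2) v * w + v * scl (\<phi>2 \<alpha>0 / 2) w)"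
    by (subst half) (simp add: scl_def algebra_simps)
  then show "D2 (t * v * w) = t * (nabla2 v * w + v * nabla2 w)"
    by (simp add: D_mult D_t nabla2_def algebra_simps)
qed

text \<open>The terms with \<open>\<phi>1 \<alpha>0 / 2\<close> and
  \<open>\<phi>2 \<alpha>0 / 2\<close> in the definition are exactly the shifts contained in
  \<open>nabla1\<close> and \<open>nabla2\<close>.\<close>

lemma even_odd_nabla:
  "EO u v = D1 u * nabla2 v - D2 u * nabla1 v + scl \<epsilon> (u * nabla1 v) - scl (\<epsilon> / 2) (D1 u * v)"
proof -
  \<comment> \<open>Scalars enter as ring elements; splitting off one common element for 1/2 makes
    the claim a commutative ring identity.\<close>
  have half: "Poly_Mapping.single 0 (c / 2) = Poly_Mapping.single 0 c * (Poly_Mapping.single 0 (1 / 2) :: ('g, 'k) alg)" for c :: 'k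
    by (simp add: mult_single)
  show ?thesis
    unfolding even_odd_def nabla1_def nabla2_def scl_def half[of \<epsilon>] half[of "\<phi>1 \<alpha>0"] half[of "\<phi>2 \<alpha>0"]
    by (simp add: algebra_simps)
qed

text \<open>Separates \<open>u\<close> from \<open>v\<close>: the two factors in \<open>u\<close>
  vanish together exactly when \<open>u\<close> is a joint eigenvector for the eigenvalues 0 and
  \<epsilon>, the central case.\<close>

lemma even_odd_factored:
  "EO u v = D1 u * (nabla2 v - scl (\<epsilon> / 2) v) - (D2 u - scl \<epsilon> u) * nabla1 v"
  by (simp add: even_odd_nabla scl_def algebra_simps)

text \<open>Leibniz rule and commutation. The 3/2 is 1 + 1/2: replacing \<open>u * nabla1 v\<close>
  by \<open>nabla1 (u * v)\<close> costs another \<open>\<epsilon> D1 u * v\<close> on top of the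
  \<open>\<epsilon>/2\<close> already present. This form bounds the image of the bracket from
  above.\<close>

lemma even_odd_total_derivative:
  "EO u v = nabla2 (D1 u * v) - nabla1 (D2 u * v) + scl \<epsilon> (nabla1 (u * v)) - scl (3 / 2 * \<epsilon>) (D1 u * v)"
proof -
  have "scl (3 / 2 * \<epsilon>) (D1 u * v) = scl \<epsilon> (D1 u * v) + scl (\<epsilon> / 2) (D1 u * v)"
    by (simp flip: alg.scale_left_distrib)
  then show ?thesis
    by (simp add: even_odd_nabla nabla_mult der1_der2_commute alg.scale_right_distrib)
qed

section \<open>Skew symmetry and the super Jacobi identity\<close>

lemma even_even_alt:
  "EE u v = D1 u * D2 v - D2 u * D1 v + scl \<epsilon> (u * D1 v) - scl \<epsilon> (D1 u * v)"
  by (simp add: even_even_def scl_def algebra_simps)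

lemma even_even_skew: "EE u v = - EE v u"
  by (simp add: even_even_alt scl_def algebra_simps)

lemma bracket_linear:
  "EE (u + u') v = EE u v + EE u' v" "EE u (v + v') = EE u v + EE u v'"
  "EE (scl c u) v = scl c (EE u v)" "EE u (scl c v) = scl c (EE u v)"
  "EO (u + u') v = EO u v + EO u' v" "EO u (v + v') = EO u v + EO u v'"
  "EO (scl c u) v = scl c (EO u v)" "EO u (scl c v) = scl c (EO u v)"
  unfolding even_even_alt even_odd_nabla D_linear nabla_linear by (simp_all add: scl_def algebra_simps)

lemma jacobi_even: "EE u (EE v w) = EE (EE u v) w + EE v (EE u w)"
  unfolding even_even_alt D_linear D_mult der1_der2_commute
  by (simp add: scl_def algebra_simps)

lemma jacobi_even_even_odd: "EO u (EO v w) = EO (EE u v) w + EO v (EO u w)"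
  unfolding even_even_alt even_odd_nabla D_linear D_mult nabla_linear nabla_mult der1_der2_commute nabla_commute
  by (simp add: scl_def algebra_simps)

text \<open>\<open>EE u\<close> is a derivation minus multiplication by
  \<open>\<epsilon> D1 u\<close>. On \<open>t * v * w\<close> that multiplication occurs once and is
  shared by the two odd factors, which explains the \<open>\<epsilon>/2\<close> in
  \<open>EO\<close>.\<close>

lemma jacobi_even_odd_odd: "EE u (t * v * w) = t * EO u v * w + t * v * EO u w"
proof -
  have half: "Poly_Mapping.single 0 \<epsilon> = Poly_Mapping.single 0 (\<epsilon> / 2) + (Poly_Mapping.single 0 (\<epsilon> / 2) :: ('g, 'k) alg)"
    by (simp flip: single_add)
  have "EE u (t * v * w) = t * (D1 u * (nabla2 v * w + v * nabla2 w) - D2 u * (nabla1 v * w + v * nabla1 w)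
      + scl \<epsilon> (u * (nabla1 v * w + v * nabla1 w)) - scl \<epsilon> (D1 u * (v * w)))"
    unfolding even_even_alt nabla_t by (simp add: scl_def algebra_simps)
  also have "\<dots> = t * EO u v * w + t * v * EO u w"
    unfolding even_odd_nabla scl_def half by (simp add: algebra_simps)
  finally show ?thesis .
qed

text \<open>By \<open>nabla_t\<close>, the terms with two nablas cancel in pairs over the cyclic
  sum, while \<open>t * u * v * nabla1 w\<close> occurs once with \<epsilon> and twice with
  -\<epsilon>/2.\<close>

lemma jacobi_odd: "EO (t * u * v) w + EO (t * v * w) u + EO (t * w * u) v = 0"
proof -
  have half: "Poly_Mapping.single 0 \<epsilon> = Poly_Mapping.single 0 (\<epsilon> / 2) + (Poly_Mapping.single 0 (\<epsilon> / 2) :: ('g, 'k) alg)"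
    by (simp flip: single_add)
  show ?thesis
    unfolding even_odd_nabla nabla_t scl_def half by (simp add: algebra_simps)
qed

lemma A_closed:
  "u \<in> A \<Longrightarrow> v \<in> A \<Longrightarrow> u * v \<in> A" "u \<in> A \<Longrightarrow> v \<in> A \<Longrightarrow> u + v \<in> A"
  "u \<in> A \<Longrightarrow> v \<in> A \<Longrightarrow> u - v \<in> A" "u \<in> A \<Longrightarrow> scl c u \<in> A"
  "u \<in> A \<Longrightarrow> D1 u \<in> A" "u \<in> A \<Longrightarrow> D2 u \<in> A"
  "u \<in> A \<Longrightarrow> nabla1 u \<in> A" "u \<in> A \<Longrightarrow> nabla2 u \<in> A" "xmon \<beta> 0 0 \<in> A" "0 \<in> A"
proof -
  have "0 \<in> J1" "0 \<in> J2"
    using J1 J2 by auto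
  then show "xmon \<beta> 0 0 \<in> A"
    by (rule xmon_carrier)
qed (auto simp: mult_carrier[OF J1 J2] der1_carrier[OF J1] der2_carrier[OF J2] nabla1_def nabla2_def
    intro!: alg.subspace_add alg.subspace_diff alg.subspace_scale alg.subspace_0 subspace_alg_carrier)

lemma bracket_carrier: "u \<in> A \<Longrightarrow> v \<in> A \<Longrightarrow> EE u v \<in> A" "u \<in> A \<Longrightarrow> v \<in> A \<Longrightarrow> EO u v \<in> A"
  by (simp_all add: even_even_def even_odd_nabla A_closed)

lemma bracket_zero [simp]: "EE 0 v = 0" "EE u 0 = 0" "EO 0 v = 0" "EO u 0 = 0"
  by (simp_all add: even_even_def even_odd_def)

lemma bracket_uminus: "EE (- u) v = - EE u v" "EE u (- v) = - EE u v" "EO (- u) v = - EO u v" "EO u (- v) = - EO u v"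
  using bracket_linear(3,4,7,8)[where c = "-1"] by (simp_all add: alg.scale_minus_left)

text \<open>A common model: the odd subspace \<open>A\<close> yields the full superalgebra and
  \<open>B1\<close> yields its subalgebra, so the axioms are checked once.\<close>

definition with_odd_part :: "('g, 'k) alg set \<Rightarrow> ('k, ('g, 'k) alg \<times> ('g, 'k) alg) superalgebra" where
  "with_odd_part M =
     \<lparr>carrier = A \<times> M,
      monoid.mult = superbracket \<phi>1 \<phi>2 \<alpha>0 \<epsilon>, one = 0, zero = 0, add = (+),
      module.smult = (\<lambda>c (u, v). (scl c u, scl c v)),
      grade = (\<lambda>i. if i then {0} \<times> M else A \<times> {0})\<rparr>"

lemma with_odd_part_simps [simp]:
  "carrier (with_odd_part M) = A \<times> M" "monoid.mult (with_odd_part M) = superbracket \<phi>1 \<phi>2 \<alpha>0 \<epsilon>"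
  "zero (with_odd_part M) = 0" "add (with_odd_part M) = (+)"
  "module.smult (with_odd_part M) = (\<lambda>c (u, v). (scl c u, scl c v))"
  "grade (with_odd_part M) i = (if i then {0} \<times> M else A \<times> {0})"
  by (simp_all add: with_odd_part_def)

lemma ring_of_type_algebra_simps [simp]:
  "carrier ring_of_type_algebra = UNIV" "monoid.mult ring_of_type_algebra = (*)"
  "one ring_of_type_algebra = 1" "add ring_of_type_algebra = (+)"
  by (simp_all add: ring_of_type_algebra_def)

lemma module_with_odd_part:
  assumes "alg.subspace M"
  shows "Module.module ring_of_type_algebra (with_odd_part M)"
proof (rule moduleI)
  note closed = alg.subspace_add[OF assms] alg.subspace_scale[OF assms] alg.subspace_0[OF assms]
    alg.subspace_neg[OF assms] alg.subspace_neg[OF subspace_alg_carrier] A_closed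
  show "cring (ring_of_type_algebra :: 'k ring)"
    by (rule cring_from_type_algebra)
  show "abelian_group (with_odd_part M)"
  proof (rule abelian_groupI)
    fix x assume "x \<in> carrier (with_odd_part M)"
    then show "\<exists>y\<in>carrier (with_odd_part M). y \<oplus>\<^bsub>with_odd_part M\<^esub> x = \<zero>\<^bsub>with_odd_part M\<^esub>"
      by (intro bexI[of _ "- x"]) (auto simp: closed)
  qed (auto simp: closed zero_prod_def algebra_simps)
  show "a \<odot>\<^bsub>with_odd_part M\<^esub> x \<in> carrier (with_odd_part M)" if "x \<in> carrier (with_odd_part M)" for a x
    using that by (auto simp: closed)
qed (auto simp: alg.scale_left_distrib alg.scale_right_distrib)

lemma minus_with_odd_part:
  assumes "alg.subspace M" "x \<in> A \<times> M"
  shows "\<ominus>\<^bsub>with_odd_part M\<^esub> x = - x"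
proof -
  interpret Module.module ring_of_type_algebra "with_odd_part M"
    using assms by (rule_tac module_with_odd_part)
  have "- x \<in> A \<times> M"
    using assms alg.subspace_neg[OF assms(1)] alg.subspace_neg[OF subspace_alg_carrier] by auto
  then show ?thesis
    using assms by (intro M.minus_equality) auto
qed

lemma submodule_with_odd_part:
  assumes "alg.subspace M"
  shows "submodule H ring_of_type_algebra (with_odd_part M) \<longleftrightarrow>
    H \<subseteq> A \<times> M \<and> 0 \<in> H \<and> (\<forall>x\<in>H. \<forall>y\<in>H. x + y \<in> H) \<and> (\<forall>c. \<forall>(u, v)\<in>H. (scl c u, scl c v) \<in> H)"
    (is "?L \<longleftrightarrow> ?R")
proof
  interpret Module.module ring_of_type_algebra "with_odd_part M"
    using assms by (rule module_with_odd_part)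
  {
    assume H: ?L
    have "0 \<in> H"
      using subgroup.one_closed[OF submodule.axioms(1)[OF H]] by simp
    with submoduleE[OF H] show ?R
      by fastforce
  }
  assume ?R
  then have R: "H \<subseteq> A \<times> M" "0 \<in> H" "\<And>x y. x \<in> H \<Longrightarrow> y \<in> H \<Longrightarrow> x + y \<in> H"
    "\<And>c u v. (u, v) \<in> H \<Longrightarrow> (scl c u, scl c v) \<in> H"
    by auto
  have "\<ominus>\<^bsub>with_odd_part M\<^esub> x \<in> H" if "x \<in> H" for x
  proof -
    have "\<ominus>\<^bsub>with_odd_part M\<^esub> x = - x"
      using that R(1) by (intro minus_with_odd_part[OF assms]) auto
    also have "\<dots> = (scl (- 1) (fst x), scl (- 1) (snd x))"
      by (simp add: prod_eq_iff alg.scale_minus_left)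
    also have "\<dots> \<in> H"
      using that by (intro R(4)) simp
    finally show ?thesis .
  qed
  then show ?L
    using R by (intro submoduleI) auto
qed

lemma superbracket_homogeneous [simp]:
  "superbracket \<phi>1 \<phi>2 \<alpha>0 \<epsilon> (u, 0) (v, 0) = (EE u v, 0)"
  "superbracket \<phi>1 \<phi>2 \<alpha>0 \<epsilon> (u, 0) (0, v) = (0, EO u v)"
  "superbracket \<phi>1 \<phi>2 \<alpha>0 \<epsilon> (0, v) (u, 0) = (0, - EO u v)"
  "superbracket \<phi>1 \<phi>2 \<alpha>0 \<epsilon> (0, v) (0, w) = (t * v * w, 0)"
  by (simp_all add: superbracket_def)

text \<open>Skew symmetry reduces the eight parity patterns to the number of odd arguments, and each
  of the four numbers has its identity above.\<close>

lemma super_jacobi_homogeneous: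
  assumes "x \<in> (if i then {0} \<times> UNIV else UNIV \<times> {0})" "y \<in> (if j then {0} \<times> UNIV else UNIV \<times> {0})"
    "z \<in> (if k then {0} \<times> UNIV else UNIV \<times> {0})"
  defines "b \<equiv> superbracket \<phi>1 \<phi>2 \<alpha>0 \<epsilon>"
  shows "b x (b y z) = b (b x y) z + (if i \<and> j then - b y (b x z) else b y (b x z))"
proof -
  obtain x' where x: "x = (if i then (0, x') else (x', 0))"
    using assms(1) by (cases i) auto
  obtain y' where y: "y = (if j then (0, y') else (y', 0))"
    using assms(2) by (cases j) auto
  obtain z' where z: "z = (if k then (0, z') else (z', 0))"
    using assms(3) by (cases k) auto
  have skew: "EE (t * x' * y') z' = - EE z' (t * x' * y')"
    by (rule even_even_skew)
  have "EO (t * y' * z') x' + EO (t * x' * y') z' + EO (t * x' * z') y' = 0"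
    using jacobi_odd[of x' y' z'] by (simp add: mult_ac add_ac)
  then have odd: "EO (t * y' * z') x' = - EO (t * x' * y') z' - EO (t * x' * z') y'"
    by (simp only: eq_diff_eq eq_neg_iff_add_eq_0 add_ac)
  show ?thesis
    unfolding x y z b_def
    by (cases i; cases j; cases k;
        simp add: bracket_uminus jacobi_even[of x'] jacobi_even_even_odd[of x'] jacobi_even_odd_odd
          jacobi_even_even_odd[of y' z'] skew odd;
        simp add: algebra_simps)
qed

lemma lie_superalgebra_with_odd_part:
  assumes M: "alg.subspace M" "M \<subseteq> A" and EO: "\<And>u v. u \<in> A \<Longrightarrow> v \<in> M \<Longrightarrow> EO u v \<in> M"
  shows "lie_superalgebra ring_of_type_algebra (with_odd_part M)"
proof (intro lie_superalgebra.intro lie_superalgebra_axioms.intro, goal_cases)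
  note closed = subsetD[OF M(2)] alg.subspace_add[OF M(1)] alg.subspace_scale[OF M(1)] alg.subspace_0[OF M(1)]
    alg.subspace_diff[OF M(1)] alg.subspace_neg[OF M(1)] alg.subspace_neg[OF subspace_alg_carrier]
    EO A_closed bracket_carrier
  {
    case 1
    show ?case by (rule field_from_type_algebra)
  next
    case 2
    show ?case by (rule module_with_odd_part[OF M(1)])
  next
    case (3 i)
    show ?case
      unfolding submodule_with_odd_part[OF M(1)] by (auto simp: zero_prod_def closed)
  next
    case 4
    show ?case
      by (auto simp: set_add_def' closed)
  next
    case 5
    show ?case
      by (auto simp: closed zero_prod_def)
  next
    case (6 x y)
    then show ?case
      by (auto simp: superbracket_def closed)
  next
    case (11 x i y j)
    then show ?case
      by (auto simp: closed)
  next
    case (12 x i y j)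
    have *: "superbracket \<phi>1 \<phi>2 \<alpha>0 \<epsilon> y x \<in> A \<times> M"
      using 12 by (auto simp: closed split: if_splits)
    show ?case
      unfolding with_odd_part_simps minus_with_odd_part[OF M(1) *]
      using 12 even_even_skew[of "fst x" "fst y"] by (auto simp: mult_ac split: if_splits)
  next
    case (13 x i y j z k)
    have *: "superbracket \<phi>1 \<phi>2 \<alpha>0 \<epsilon> y (superbracket \<phi>1 \<phi>2 \<alpha>0 \<epsilon> x z) \<in> A \<times> M"
      using 13 by (auto simp: closed split: if_splits)
    show ?case
      unfolding with_odd_part_simps minus_with_odd_part[OF M(1) *]
      using 13 by (intro super_jacobi_homogeneous[where i = i and j = j and k = k]) (auto split: if_splits)
  }
qed (auto simp: superbracket_def bracket_linear algebra_simps scl_mult_left scl_mult_right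
    alg.scale_right_diff_distrib alg.scale_right_distrib)

end

section \<open>The odd part\<close>

text \<open>\<open>sep1\<close> and \<open>sep2\<close> express what the kernel condition provides
  for \<epsilon> = 0: in each direction a polynomial variable, or a weight on which that
  homomorphism alone is nonzero.\<close>

locale nondegenerate_contact_bracket = contact_bracket \<phi>1 \<phi>2 \<alpha>0 \<epsilon> J1 J2
  for \<phi>1 \<phi>2 :: "'g::ab_group_add \<Rightarrow> 'k::field_char_0"
    and \<alpha>0 :: 'g and \<epsilon> :: 'k and J1 J2 :: "nat set" +
  assumes ker: "\<phi>1 \<alpha> = 0 \<Longrightarrow> \<phi>2 \<alpha> = 0 \<Longrightarrow> \<alpha> = 0"
    and \<epsilon>: "\<epsilon> = 0 \<or> \<epsilon> = 1"
    and nz1: "J1 = UNIV \<or> (\<exists>\<alpha>. \<phi>1 \<alpha> \<noteq> 0)"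
    and sep1: "\<epsilon> = 0 \<Longrightarrow> J1 = UNIV \<or> (\<exists>\<alpha>. \<phi>1 \<alpha> \<noteq> 0 \<and> \<phi>2 \<alpha> = 0)"
    and sep2: "\<epsilon> = 0 \<Longrightarrow> J2 = UNIV \<or> (\<exists>\<alpha>. \<phi>1 \<alpha> = 0 \<and> \<phi>2 \<alpha> \<noteq> 0)"
begin

lemmas \<phi>_add = additive.add[OF \<phi>1] additive.add[OF \<phi>2]
lemmas \<phi>_diff = additive.diff[OF \<phi>1] additive.diff[OF \<phi>2]
lemmas \<phi>_zero [simp] = additive.zero[OF \<phi>1] additive.zero[OF \<phi>2]

lemma nabla_xmon:
  "nabla1 (xmon \<beta> i j) = scl (\<phi>1 \<beta> + \<phi>1 \<alpha>0 / 2) (xmon \<beta> i j) + scl (of_nat i) (xmon \<beta> (i - 1) j)"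
  "nabla2 (xmon \<beta> i j) = scl (\<phi>2 \<beta> + \<phi>2 \<alpha>0 / 2) (xmon \<beta> i j) + scl (of_nat j) (xmon \<beta> i (j - 1))"
  by (simp_all add: nabla1_def nabla2_def der1_xmon der2_xmon alg.scale_left_distrib)

lemma D_one: "D1 1 = 0" "D2 1 = 0"
  using der1_xmon[of \<phi>1 0 0 0] der2_xmon[of \<phi>2 0 0 0] by (simp_all add: xmon_zero)

definition B1 :: "('g, 'k) alg set" where
  "B1 = alg.span {EO u v | u v. u \<in> A \<and> v \<in> A}"

text \<open>The weights killed by both \<open>nabla1\<close> and
  \<open>nabla2 - 3/2 \<epsilon>\<close>. A polynomial variable makes one of these operators
  surjective on every weight space, hence the restriction on the index sets.\<close>

definition exceptional :: "'g set" where
  "exceptional = {\<gamma>. J1 = {0} \<and> J2 = {0} \<and> \<phi>1 \<gamma> + \<phi>1 \<alpha>0 / 2 = 0 \<and> \<phi>2 \<gamma> + \<phi>2 \<alpha>0 / 2 = 3 / 2 * \<epsilon>}"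

text \<open>The equations fix both \<open>\<phi>1 \<gamma>\<close> and
  \<open>\<phi>2 \<gamma>\<close>, and the kernels meet only in 0. This is the source of the
  codimension bound.\<close>

lemma exceptional_unique:
  assumes "\<gamma> \<in> exceptional" "\<gamma>' \<in> exceptional"
  shows "\<gamma> = \<gamma>'"
proof -
  have "\<phi>1 \<gamma> + \<phi>1 \<alpha>0 / 2 = \<phi>1 \<gamma>' + \<phi>1 \<alpha>0 / 2" "\<phi>2 \<gamma> + \<phi>2 \<alpha>0 / 2 = \<phi>2 \<gamma>' + \<phi>2 \<alpha>0 / 2"
    using assms unfolding exceptional_def mem_Collect_eq by metis+
  then show ?thesis
    using ker[of "\<gamma> - \<gamma>'"] by (simp add: \<phi>_diff)
qed

lemma subspace_B1: "alg.subspace B1"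
  unfolding B1_def by (rule alg.subspace_span)

lemma EO_in_B1: "u \<in> A \<Longrightarrow> v \<in> A \<Longrightarrow> EO u v \<in> B1"
  unfolding B1_def by (rule alg.span_base) auto

lemma B1_subset_A: "B1 \<subseteq> A"
  unfolding B1_def by (intro alg.span_minimal subspace_alg_carrier) (auto simp: bracket_carrier)

text \<open>Surjectivity of \<open>c\<close> plus differentiation on polynomials in one variable,
  with \<open>f i\<close> as the i-th power. For \<open>c = 0\<close> one integrates: the relation
  at \<open>Suc i\<close> leaves a nonzero multiple of \<open>f i\<close>. Otherwise the system is
  triangular and is solved upwards from 0.\<close>

lemma ladder_mem:
  fixes f :: "nat \<Rightarrow> ('g, 'k) alg"
  assumes S: "alg.subspace S" and J: "J \<in> {{0}, UNIV}" and c: "c \<noteq> 0 \<or> J = UNIV"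
    and step: "\<And>i. i \<in> J \<Longrightarrow> scl c (f i) + scl (of_nat i) (f (i - 1)) \<in> S" and "i \<in> J"
  shows "f i \<in> S"
proof (cases "c = 0")
  case True
  then have "scl (of_nat (Suc i)) (f i) \<in> S"
    using c step[of "Suc i"] by simp
  then have "scl (inverse (of_nat (Suc i))) (scl (of_nat (Suc i)) (f i)) \<in> S"
    by (rule alg.subspace_scale[OF S])
  moreover have "(of_nat (Suc i) :: 'k) \<noteq> 0"
    by (rule of_nat_neq_0)
  ultimately show ?thesis
    by (simp del: of_nat_Suc)
next
  case False
  have inv: "f i \<in> S" if "scl c (f i) \<in> S" for i
    using alg.subspace_scale[OF S that, of "inverse c"] False by simp
  show ?thesis
    using \<open>i \<in> J\<close>
  proof (induction i)
    case 0
    then show ?case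
      using step[of 0] by (intro inv) simp
  next
    case (Suc i)
    then have "f i \<in> S"
      using J by auto
    then have "scl c (f (Suc i)) + scl (of_nat (Suc i)) (f i) - scl (of_nat (Suc i)) (f i) \<in> S"
      using step[of "Suc i"] Suc.prems by (intro alg.subspace_diff[OF S] alg.subspace_scale[OF S]) auto
    then show ?case
      by (intro inv) simp
  qed
qed

definition regular :: "('g, 'k) alg set" where
  "regular = {u \<in> A. \<forall>\<gamma>\<in>exceptional. Poly_Mapping.lookup u (\<gamma>, 0, 0) = 0}"

lemma regular_subset:
  assumes S: "alg.subspace S"
    and mon: "\<And>\<gamma> i j. \<gamma> \<notin> exceptional \<Longrightarrow> i \<in> J1 \<Longrightarrow> j \<in> J2 \<Longrightarrow> xmon \<gamma> i j \<in> S"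
  shows "regular \<subseteq> S"
proof
  fix u assume u: "u \<in> regular"
  have "(\<Sum>(\<alpha>, i, j)\<in>Poly_Mapping.keys u. scl (Poly_Mapping.lookup u (\<alpha>, i, j)) (xmon \<alpha> i j)) \<in> S"
  proof (rule alg.subspace_sum[OF S], clarify)
    fix \<alpha> i j assume k: "(\<alpha>, i, j) \<in> Poly_Mapping.keys u"
    then have ij: "i \<in> J1" "j \<in> J2"
      using u by (auto simp: regular_def alg_carrier_def)
    have "\<alpha> \<notin> exceptional"
    proof
      assume \<alpha>: "\<alpha> \<in> exceptional"
      then have "i = 0" "j = 0"
        using ij by (auto simp: exceptional_def)
      then show False
        using \<alpha> u k by (auto simp: regular_def in_keys_iff)
    qed
    then show "scl (Poly_Mapping.lookup u (\<alpha>, i, j)) (xmon \<alpha> i j) \<in> S"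
      using ij by (intro alg.subspace_scale[OF S] mon)
  qed
  then show "u \<in> S"
    using alg_expand[of u] by simp
qed

lemma unit_multiple:
  assumes "d = scl c (xmon \<delta> 0 0)" "c \<noteq> 0" "w \<in> A"
  obtains v where "v \<in> A" "d * v = w"
proof
  show "scl (inverse c) (xmon (- \<delta>) 0 0 * w) \<in> A"
    using assms by (intro A_closed)
  show "d * scl (inverse c) (xmon (- \<delta>) 0 0 * w) = w"
    using xmon_uminus_mult[of "- \<delta>" w] assms by (simp add: scl_mult_left scl_mult_right)
qed

text \<open>For \<epsilon> = 0, an \<open>a\<close> with \<open>D1 a = 0\<close> and
  \<open>D2 a\<close> a unit reduces the total derivative formula to
  \<open>EO a v = - nabla1 (D2 a * v)\<close>, and \<open>D2 a * v\<close> can be any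
  \<open>w\<close>.\<close>

lemma nabla1_in_B1:
  assumes w: "w \<in> A"
  shows "nabla1 w \<in> B1"
proof (cases "\<epsilon> = 0")
  case True
  have "\<exists>a c \<delta>. a \<in> A \<and> D1 a = 0 \<and> D2 a = scl c (xmon \<delta> 0 0) \<and> c \<noteq> 0"
    using sep2[OF True]
  proof
    assume "J2 = UNIV"
    then have "xmon 0 0 1 \<in> A"
      using J1 by (intro xmon_carrier) auto
    then show ?thesis
      by (intro exI[of _ "xmon 0 0 1"] exI[of _ 1] exI[of _ 0]) (simp add: der1_xmon der2_xmon)
  next
    assume "\<exists>\<alpha>. \<phi>1 \<alpha> = 0 \<and> \<phi>2 \<alpha> \<noteq> 0"
    then obtain \<alpha> where "\<phi>1 \<alpha> = 0" "\<phi>2 \<alpha> \<noteq> 0"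
      by blast
    then show ?thesis
      by (intro exI[of _ "xmon \<alpha> 0 0"] exI[of _ "\<phi>2 \<alpha>"] exI[of _ \<alpha>]) (simp add: der1_xmon der2_xmon A_closed)
  qed
  then obtain a c \<delta> where a: "a \<in> A" "D1 a = 0" "D2 a = scl c (xmon \<delta> 0 0)" "c \<noteq> 0"
    by blast
  obtain v where v: "v \<in> A" "D2 a * v = w"
    using unit_multiple[OF a(3,4) w] .
  have "nabla1 w = scl (- 1) (EO a v)"
    using even_odd_total_derivative[of a v] by (simp add: v(2) a(2) True nabla2_def)
  then show ?thesis
    using EO_in_B1[OF a(1) v(1)] alg.subspace_scale[OF subspace_B1] by metis
next
  case False
  \<comment> \<open>Both derivations kill the identity, so only the term
    \<open>\<epsilon> (u * nabla1 v)\<close> survives.\<close>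
  then have "EO (xmon 0 0 0) w = nabla1 w"
    using \<epsilon> even_odd_nabla[of "xmon 0 0 0" w] by (simp add: D_one xmon_zero)
  then show ?thesis
    using EO_in_B1[OF A_closed(9) w, of 0] by simp
qed

text \<open>Here \<open>D1 a\<close> is a unit. The two remaining terms of the total derivative
  formula are values of \<open>nabla1\<close>, already known to lie in \<open>B1\<close>.\<close>

lemma nabla2_in_B1:
  assumes w: "w \<in> A"
  shows "nabla2 w - scl (3 / 2 * \<epsilon>) w \<in> B1"
proof -
  have "\<exists>a c \<delta>. a \<in> A \<and> D1 a = scl c (xmon \<delta> 0 0) \<and> c \<noteq> 0"
    using nz1
  proof
    assume "J1 = UNIV"
    then have "xmon 0 1 0 \<in> A"
      using J2 by (intro xmon_carrier) auto
    then show ?thesis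
      by (intro exI[of _ "xmon 0 1 0"] exI[of _ 1] exI[of _ 0]) (simp add: der1_xmon der2_xmon)
  next
    assume "\<exists>\<alpha>. \<phi>1 \<alpha> \<noteq> 0"
    then obtain \<alpha> where "\<phi>1 \<alpha> \<noteq> 0"
      by blast
    then show ?thesis
      by (intro exI[of _ "xmon \<alpha> 0 0"] exI[of _ "\<phi>1 \<alpha>"] exI[of _ \<alpha>]) (simp add: der1_xmon der2_xmon A_closed)
  qed
  then obtain a c \<delta> where a: "a \<in> A" "D1 a = scl c (xmon \<delta> 0 0)" "c \<noteq> 0"
    by blast
  obtain v where v: "v \<in> A" "D1 a * v = w"
    using unit_multiple[OF a(2,3) w] .
  have "nabla2 w - scl (3 / 2 * \<epsilon>) w = EO a v + nabla1 (D2 a * v) - scl \<epsilon> (nabla1 (a * v))"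
    unfolding even_odd_total_derivative v(2) by simp
  also have "\<dots> \<in> B1"
    using a(1) v(1) subspace_B1
    by (intro alg.subspace_add alg.subspace_diff alg.subspace_scale EO_in_B1 nabla1_in_B1 A_closed)
  finally show ?thesis .
qed

lemma B1_eq: "B1 = regular"
proof
  show "B1 \<subseteq> regular"
    unfolding B1_def
  proof (rule alg.span_minimal)
    show "alg.subspace regular"
      unfolding alg.subspace_def regular_def by (auto simp: A_closed lookup_add lookup_scl)
    \<comment> \<open>At an exceptional weight \<open>nabla1\<close> has coefficient 0, and
      \<open>nabla2\<close> contributes \<open>3/2 \<epsilon>\<close> times that of
      \<open>D1 u * v\<close>, which the last term of the total derivative formula cancels.\<close>
    have "Poly_Mapping.lookup (EO u v) (\<gamma>, 0, 0) = 0" if "u \<in> A" "v \<in> A" "\<gamma> \<in> exceptional" for u v \<gamma>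
    proof -
      have 1: "Poly_Mapping.lookup w (\<gamma>, Suc 0, 0) = 0" "Poly_Mapping.lookup w (\<gamma>, 0, Suc 0) = 0" if "w \<in> A" for w
        using that \<open>\<gamma> \<in> exceptional\<close> by (auto simp: alg_carrier_def exceptional_def in_keys_iff)
      have 2: "Poly_Mapping.lookup (nabla1 w) (\<gamma>, 0, 0) = 0" if "w \<in> A" for w
      proof -
        have "Poly_Mapping.lookup (nabla1 w) (\<gamma>, 0, 0) = (\<phi>1 \<gamma> + \<phi>1 \<alpha>0 / 2) * Poly_Mapping.lookup w (\<gamma>, 0, 0)"
          using 1(1)[OF that] by (simp add: nabla1_def lookup_add lookup_der1 lookup_scl algebra_simps)
        then show ?thesis
          using \<open>\<gamma> \<in> exceptional\<close> by (simp add: exceptional_def)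
      qed
      have 3: "Poly_Mapping.lookup (nabla2 w) (\<gamma>, 0, 0) = 3 / 2 * \<epsilon> * Poly_Mapping.lookup w (\<gamma>, 0, 0)" if "w \<in> A" for w
      proof -
        have "Poly_Mapping.lookup (nabla2 w) (\<gamma>, 0, 0) = (\<phi>2 \<gamma> + \<phi>2 \<alpha>0 / 2) * Poly_Mapping.lookup w (\<gamma>, 0, 0)"
          using 1(2)[OF that] by (simp add: nabla2_def lookup_add lookup_der2 lookup_scl algebra_simps)
        then show ?thesis
          using \<open>\<gamma> \<in> exceptional\<close> by (simp add: exceptional_def)
      qed
      show ?thesis
        using that(1,2) unfolding even_odd_total_derivative
        by (simp add: lookup_add lookup_minus lookup_scl 2 3 A_closed)
    qed
    then show "{EO u v |u v. u \<in> A \<and> v \<in> A} \<subseteq> regular"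
      by (auto simp: regular_def bracket_carrier)
  qed
  show "regular \<subseteq> B1"
  proof (rule regular_subset[OF subspace_B1])
    fix \<gamma> i j assume \<gamma>: "\<gamma> \<notin> exceptional" and i: "i \<in> J1" and j: "j \<in> J2"
    show "xmon \<gamma> i j \<in> B1"
    \<comment> \<open>Climb in the first variable with \<open>nabla1\<close> where it is surjective,
      otherwise in the second with \<open>nabla2 - 3/2 \<epsilon>\<close>.\<close>
    proof (cases "\<phi>1 \<gamma> + \<phi>1 \<alpha>0 / 2 \<noteq> 0 \<or> J1 = UNIV")
      case True
      have "scl (\<phi>1 \<gamma> + \<phi>1 \<alpha>0 / 2) (xmon \<gamma> i' j) + scl (of_nat i') (xmon \<gamma> (i' - 1) j) \<in> B1" if "i' \<in> J1" for i'
        using nabla1_in_B1[OF xmon_carrier[OF that j]] by (simp only: nabla_xmon)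
      then show ?thesis
        by (rule ladder_mem[OF subspace_B1 J1 True]) (use i in auto)
    next
      case False
      then have c: "\<phi>2 \<gamma> + \<phi>2 \<alpha>0 / 2 - 3 / 2 * \<epsilon> \<noteq> 0 \<or> J2 = UNIV"
        using \<gamma> J1 J2 by (auto simp: exceptional_def)
      have "scl (\<phi>2 \<gamma> + \<phi>2 \<alpha>0 / 2 - 3 / 2 * \<epsilon>) (xmon \<gamma> i j') + scl (of_nat j') (xmon \<gamma> i (j' - 1)) \<in> B1"
        if "j' \<in> J2" for j'
        using nabla2_in_B1[OF xmon_carrier[OF i that]]
        by (simp add: nabla_xmon alg.scale_left_diff_distrib algebra_simps)
      then show ?thesis
        by (rule ladder_mem[OF subspace_B1 J2 c]) (use j in auto)
    qed
  qed
qed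

lemma xmon_in_B1: "\<gamma> \<notin> exceptional \<Longrightarrow> i \<in> J1 \<Longrightarrow> j \<in> J2 \<Longrightarrow> xmon \<gamma> i j \<in> B1"
  unfolding B1_eq regular_def by (auto simp: xmon_carrier lookup_xmon)

text \<open>Enlarging \<open>exceptional\<close> to finite sets makes the condition below stable under translation.
  When the polynomial variables are present there are no exceptional weights, and \<open>'g\<close> may be finite.\<close>

definition small :: "'g set \<Rightarrow> bool" where
  "small F \<longleftrightarrow> F = {} \<or> (J1 = {0} \<and> J2 = {0} \<and> finite F)"

lemma small_exceptional: "small exceptional"
proof -
  have "exceptional \<subseteq> {\<gamma>}" if "\<gamma> \<in> exceptional" for \<gamma>
    using exceptional_unique[OF _ that] by auto
  then have "finite exceptional"
    by (metis equals0I finite.emptyI finite_insert finite_subset)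
  then show ?thesis
    by (auto simp: small_def exceptional_def)
qed

lemma small_Un: "small F \<Longrightarrow> small F' \<Longrightarrow> small (F \<union> F')"
  and small_image: "small F \<Longrightarrow> small (f ` F)"
  and small_empty: "small {}"
  by (auto simp: small_def)

text \<open>The multiples \<open>m n\<close> of \<open>a\<close> are pairwise distinct, by
  characteristic 0 and the trivial intersection of the kernels. Along them the affine function is
  either a nonzero constant or has at most one root, so only finitely many multiples are
  bad.\<close>

lemma affine_avoid:
  fixes c0 :: 'k
  assumes F: "finite F" and a: "a \<noteq> 0" and nz: "r * \<phi>1 a + s * \<phi>2 a \<noteq> 0 \<or> c0 \<noteq> 0"
  obtains \<alpha> where "\<alpha> \<notin> F" "r * \<phi>1 \<alpha> + s * \<phi>2 \<alpha> + c0 \<noteq> 0"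
proof -
  define m where "m n = ((+) a ^^ n) 0" for n :: nat
  have m: "\<phi>1 (m n) = of_nat n * \<phi>1 a" "\<phi>2 (m n) = of_nat n * \<phi>2 a" for n
    by (induction n) (auto simp: m_def \<phi>_add algebra_simps)
  have "inj m"
    using a ker[of a] by (intro injI) (metis m mult_right_cancel of_nat_eq_iff)
  then have "finite (m -` F)"
    using F by (intro finite_vimageI)
  moreover have "finite {n. r * \<phi>1 (m n) + s * \<phi>2 (m n) + c0 = 0}"
  proof (cases "r * \<phi>1 a + s * \<phi>2 a = 0")
    case True
    then have "r * \<phi>1 (m n) + s * \<phi>2 (m n) = 0" for n
      unfolding m by (metis distrib_left mult.left_commute mult_zero_right)
    then show ?thesis
      using nz True by simp
  next
    case False
    have "r * \<phi>1 (m n) + s * \<phi>2 (m n) + c0 = of_nat n * (r * \<phi>1 a + s * \<phi>2 a) + c0" for n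
      unfolding m by (simp add: algebra_simps)
    then have "n = k" if "r * \<phi>1 (m n) + s * \<phi>2 (m n) + c0 = 0" "r * \<phi>1 (m k) + s * \<phi>2 (m k) + c0 = 0" for n k
      using that False by (metis add_right_cancel mult_right_cancel of_nat_eq_iff)
    then have "{n. r * \<phi>1 (m n) + s * \<phi>2 (m n) + c0 = 0} \<subseteq> {k}"
      if "r * \<phi>1 (m k) + s * \<phi>2 (m k) + c0 = 0" for k
      using that by auto
    then show ?thesis
      by (metis (mono_tags, lifting) equals0I finite.emptyI finite_insert finite_subset mem_Collect_eq)
  qed
  ultimately have "finite (m -` F \<union> {n. r * \<phi>1 (m n) + s * \<phi>2 (m n) + c0 = 0})"
    by simp
  then obtain n where "n \<notin> m -` F \<union> {n. r * \<phi>1 (m n) + s * \<phi>2 (m n) + c0 = 0}"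
    using ex_new_if_finite infinite_UNIV_nat by blast
  then show ?thesis
    using that[of "m n"] by auto
qed

text \<open>A nonempty small set forces \<open>J1 = {0}\<close>, and \<open>nz1\<close> then
  supplies a weight with infinitely many multiples. The constant 1 makes the affine requirement
  automatic.\<close>

lemma small_avoid:
  assumes "small F"
  obtains \<beta> where "\<beta> \<notin> F"
proof (cases "F = {}")
  case False
  then obtain a where "\<phi>1 a \<noteq> 0" "finite F"
    using assms nz1 by (auto simp: small_def)
  then show ?thesis
    using that affine_avoid[of F a 0 0 1] by (metis \<phi>_zero(1) zero_neq_one)
qed (use that in auto)

end

section \<open>Ideals\<close>

text \<open>At the last nonzero index the recursion reads \<open>d * f m = 0\<close>, so
  \<open>d = 0\<close>; then every later value vanishes.\<close>

lemma eigen_sequence: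
  fixes f :: "nat \<Rightarrow> 'k::field_char_0"
  assumes fin: "finite {n. f n \<noteq> 0}" and rec: "\<And>n. d * f n + of_nat (Suc n) * f (Suc n) = 0" and "f i \<noteq> 0"
  shows "d = 0" "i = 0"
proof -
  define m where "m = Max {n. f n \<noteq> 0}"
  have "m \<in> {n. f n \<noteq> 0}"
    unfolding m_def using assms(3) by (intro Max_in[OF fin]) auto
  moreover have "f (Suc m) = 0"
    using Max_ge[OF fin, of "Suc m"] unfolding m_def by auto
  ultimately show "d = 0"
    using rec[of m] by simp
  then have "f (Suc n) = 0" for n
    using rec[of n] by (simp del: of_nat_Suc)
  then show "i = 0"
    using assms(3) by (cases i) auto
qed

context nondegenerate_contact_bracket
begin

lemma small_UNIV:
  assumes "J1 = UNIV \<or> J2 = UNIV" "small F"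
  shows "F = {}"
proof -
  have "(UNIV :: nat set) \<noteq> {0}"
    by (metis UNIV_I singletonD zero_neq_one)
  then show ?thesis
    using assms unfolding small_def by metis
qed

lemma eigenvector:
  assumes D1: "D1 u = scl c1 u" and D2: "D2 u = scl c2 u" and k: "Poly_Mapping.lookup u (\<beta>, i, j) \<noteq> 0"
  shows "\<phi>1 \<beta> = c1" "\<phi>2 \<beta> = c2" "i = 0" "j = 0"
proof -
  have fin: "finite {k. Poly_Mapping.lookup u k \<noteq> 0}"
    by (rule finite_lookup)
  have "(\<phi>1 \<beta> - c1) * Poly_Mapping.lookup u (\<beta>, n, j) + of_nat (Suc n) * Poly_Mapping.lookup u (\<beta>, Suc n, j) = 0" for n
    using arg_cong[OF D1, of "\<lambda>w. Poly_Mapping.lookup w (\<beta>, n, j)"]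
    by (simp add: lookup_der1 lookup_scl algebra_simps)
  moreover have "finite {n. Poly_Mapping.lookup u (\<beta>, n, j) \<noteq> 0}"
    using finite_vimageI[OF fin, of "\<lambda>n. (\<beta>, n, j)"] by (simp add: vimage_def inj_def)
  ultimately have "\<phi>1 \<beta> - c1 = 0 \<and> i = 0"
    using eigen_sequence[of "\<lambda>n. Poly_Mapping.lookup u (\<beta>, n, j)"] k by blast
  then show "\<phi>1 \<beta> = c1" "i = 0"
    by simp_all
  have "(\<phi>2 \<beta> - c2) * Poly_Mapping.lookup u (\<beta>, i, n) + of_nat (Suc n) * Poly_Mapping.lookup u (\<beta>, i, Suc n) = 0" for n
    using arg_cong[OF D2, of "\<lambda>w. Poly_Mapping.lookup w (\<beta>, i, n)"]
    by (simp add: lookup_der2 lookup_scl algebra_simps)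
  moreover have "finite {n. Poly_Mapping.lookup u (\<beta>, i, n) \<noteq> 0}"
    using finite_vimageI[OF fin, of "\<lambda>n. (\<beta>, i, n)"] by (simp add: vimage_def inj_def)
  ultimately have "\<phi>2 \<beta> - c2 = 0 \<and> j = 0"
    using eigen_sequence[of "\<lambda>n. Poly_Mapping.lookup u (\<beta>, i, n)"] k by blast
  then show "\<phi>2 \<beta> = c2" "j = 0"
    by simp_all
qed

text \<open>Polynomial parts cannot occur in an eigenvector, and the two eigenvalues determine the
  weight because the kernels meet trivially.\<close>

lemma eigenvector_monomial:
  assumes "D1 u = scl c1 u" "D2 u = scl c2 u" "u \<noteq> 0"
  obtains \<beta> c where "u = scl c (xmon \<beta> 0 0)" "c \<noteq> 0" "\<phi>1 \<beta> = c1" "\<phi>2 \<beta> = c2"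
proof -
  obtain \<beta> i j where k: "Poly_Mapping.lookup u (\<beta>, i, j) \<noteq> 0"
    using assms(3) by (metis poly_mapping_eqI lookup_zero prod_cases3)
  note \<beta> = eigenvector[OF assms(1,2) k]
  have "u = scl (Poly_Mapping.lookup u (\<beta>, 0, 0)) (xmon \<beta> 0 0)"
  proof (rule poly_mapping_eqI)
    fix k :: "'g \<times> nat \<times> nat"
    obtain \<gamma> i j where [simp]: "k = (\<gamma>, i, j)"
      by (cases k)
    show "Poly_Mapping.lookup u k = Poly_Mapping.lookup (scl (Poly_Mapping.lookup u (\<beta>, 0, 0)) (xmon \<beta> 0 0)) k"
    proof (cases "Poly_Mapping.lookup u (\<gamma>, i, j) = 0")
      case True
      then show ?thesis
        by (auto simp: lookup_scl lookup_xmon)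
    next
      case False
      have "\<gamma> - \<beta> = 0"
        using ker[of "\<gamma> - \<beta>"] eigenvector[OF assms(1,2) False] \<beta> by (simp add: \<phi>_diff)
      then show ?thesis
        using eigenvector[OF assms(1,2) False] by (simp add: lookup_scl lookup_xmon)
    qed
  qed
  then show ?thesis
    using that k \<beta> by metis
qed

text \<open>Subtracting the eigenvalue of one weight from a derivation strictly shrinks the order ideal
  generated by the support, so a minimal nonzero element is a common eigenvector.\<close>

lemma one_in_differential_ideal:
  assumes S: "alg.subspace S" and ideal: "\<And>a u. a \<in> A \<Longrightarrow> u \<in> S \<Longrightarrow> a * u \<in> S"
    and D1: "\<And>u. u \<in> S \<Longrightarrow> D1 u \<in> S" and D2: "\<And>u. u \<in> S \<Longrightarrow> D2 u \<in> S"
    and "w \<in> S" "w \<noteq> 0"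
  shows "1 \<in> S"
proof -
  \<comment> \<open>The support alone is no good measure, since differentiation creates new lower
    exponents; its downward closure never grows.\<close>
  define down where "down u = {(\<alpha>, i, j). \<exists>i'\<ge>i. \<exists>j'\<ge>j. Poly_Mapping.lookup u (\<alpha>, i', j') \<noteq> 0}"
    for u :: "('g, 'k) alg"
  have mem_down: "(\<alpha>, i, j) \<in> down u \<longleftrightarrow> (\<exists>i'\<ge>i. \<exists>j'\<ge>j. Poly_Mapping.lookup u (\<alpha>, i', j') \<noteq> 0)" for u \<alpha> i j
    by (simp add: down_def)
  have finite_down: "finite (down u)" for u
  proof (rule finite_subset)
    show "down u \<subseteq> (\<Union>k\<in>Poly_Mapping.keys u. {fst k} \<times> {..fst (snd k)} \<times> {..snd (snd k)})"
    proof clarify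
      fix \<alpha> i j assume "(\<alpha>, i, j) \<in> down u"
      then obtain i' j' where "i \<le> i'" "j \<le> j'" "(\<alpha>, i', j') \<in> Poly_Mapping.keys u"
        unfolding mem_down in_keys_iff by blast
      then show "(\<alpha>, i, j) \<in> (\<Union>k\<in>Poly_Mapping.keys u. {fst k} \<times> {..fst (snd k)} \<times> {..snd (snd k)})"
        by (intro UN_I[of "(\<alpha>, i', j')"]) simp_all
    qed
    show "finite (\<Union>k\<in>Poly_Mapping.keys u. {fst k} \<times> {..fst (snd k)} \<times> {..snd (snd k)})"
      by (intro finite_UN_I finite_keys finite_cartesian_product) simp_all
  qed
  obtain u where u: "u \<in> S" "u \<noteq> 0"
    and min: "\<And>v. v \<in> S \<Longrightarrow> v \<noteq> 0 \<Longrightarrow> card (down u) \<le> card (down v)"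
    using ex_has_least_nat[of "\<lambda>u. u \<in> S \<and> u \<noteq> 0" w "\<lambda>u. card (down u)"] assms(5,6) by auto
  have zero: "v = 0" if "v \<in> S" "down v \<subset> down u" for v
    using min[OF that(1)] psubset_card_mono[OF finite_down that(2)] by auto
  obtain \<beta> i j where k: "Poly_Mapping.lookup u (\<beta>, i, j) \<noteq> 0"
    using u(2) by (metis poly_mapping_eqI lookup_zero prod_cases3)
  have fin: "finite {k. Poly_Mapping.lookup u k \<noteq> 0}"
    by (rule finite_lookup)
  have "D1 u - scl (\<phi>1 \<beta>) u = 0"
  proof (rule zero)
    show "D1 u - scl (\<phi>1 \<beta>) u \<in> S"
      using u(1) by (intro alg.subspace_diff[OF S] alg.subspace_scale[OF S] D1)
    have lookup: "Poly_Mapping.lookup (D1 u - scl (\<phi>1 \<beta>) u) (\<alpha>, i, j) =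
        (\<phi>1 \<alpha> - \<phi>1 \<beta>) * Poly_Mapping.lookup u (\<alpha>, i, j) + of_nat (Suc i) * Poly_Mapping.lookup u (\<alpha>, Suc i, j)" for \<alpha> i j
      by (simp add: lookup_minus lookup_der1 lookup_scl algebra_simps)
    \<comment> \<open>On the weight \<beta> the shifted derivation only lowers the first exponent,
      so the largest one, \<open>Max I\<close>, drops out of the downward closure.\<close>
    define I where "I = {i. \<exists>j. Poly_Mapping.lookup u (\<beta>, i, j) \<noteq> 0}"
    have "I \<subseteq> (\<lambda>k. fst (snd k)) ` {k. Poly_Mapping.lookup u k \<noteq> 0}"
      unfolding I_def by force
    then have I: "finite I"
      using fin by (meson finite_imageI finite_subset)
    moreover have "I \<noteq> {}"
      using k by (auto simp: I_def)
    ultimately have "Max I \<in> I"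
      by (rule Max_in)
    then obtain j0 where j0: "Poly_Mapping.lookup u (\<beta>, Max I, j0) \<noteq> 0"
      by (auto simp: I_def)
    have "Poly_Mapping.lookup (D1 u - scl (\<phi>1 \<beta>) u) (\<beta>, i', j') = 0" if "i' \<ge> Max I" for i' j'
    proof -
      have "Suc i' \<notin> I"
        using that Max_ge[OF I, of "Suc i'"] by auto
      then show ?thesis
        unfolding lookup by (simp add: I_def)
    qed
    then have "(\<beta>, Max I, j0) \<notin> down (D1 u - scl (\<phi>1 \<beta>) u)"
      by (auto simp: mem_down)
    moreover have "(\<beta>, Max I, j0) \<in> down u"
      using j0 by (auto simp: mem_down)
    moreover have "down (D1 u - scl (\<phi>1 \<beta>) u) \<subseteq> down u"
    proof clarify
      fix \<alpha> i j assume "(\<alpha>, i, j) \<in> down (D1 u - scl (\<phi>1 \<beta>) u)"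
      then obtain i' j' where ij: "i' \<ge> i" "j' \<ge> j" "Poly_Mapping.lookup (D1 u - scl (\<phi>1 \<beta>) u) (\<alpha>, i', j') \<noteq> 0"
        unfolding mem_down by blast
      then have "Poly_Mapping.lookup u (\<alpha>, i', j') \<noteq> 0 \<or> Poly_Mapping.lookup u (\<alpha>, Suc i', j') \<noteq> 0"
        unfolding lookup by auto
      then show "(\<alpha>, i, j) \<in> down u"
        using ij(1,2) unfolding mem_down by (meson le_Suc_eq)
    qed
    ultimately show "down (D1 u - scl (\<phi>1 \<beta>) u) \<subset> down u"
      by blast
  qed
  moreover have "D2 u - scl (\<phi>2 \<beta>) u = 0"
  proof (rule zero)
    show "D2 u - scl (\<phi>2 \<beta>) u \<in> S"
      using u(1) by (intro alg.subspace_diff[OF S] alg.subspace_scale[OF S] D2)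
    have lookup: "Poly_Mapping.lookup (D2 u - scl (\<phi>2 \<beta>) u) (\<alpha>, i, j) =
        (\<phi>2 \<alpha> - \<phi>2 \<beta>) * Poly_Mapping.lookup u (\<alpha>, i, j) + of_nat (Suc j) * Poly_Mapping.lookup u (\<alpha>, i, Suc j)" for \<alpha> i j
      by (simp add: lookup_minus lookup_der2 lookup_scl algebra_simps)
    define I where "I = {j. \<exists>i. Poly_Mapping.lookup u (\<beta>, i, j) \<noteq> 0}"
    have "I \<subseteq> (\<lambda>k. snd (snd k)) ` {k. Poly_Mapping.lookup u k \<noteq> 0}"
      unfolding I_def by force
    then have I: "finite I"
      using fin by (meson finite_imageI finite_subset)
    moreover have "I \<noteq> {}"
      using k by (auto simp: I_def)
    ultimately have "Max I \<in> I"
      by (rule Max_in)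
    then obtain i0 where i0: "Poly_Mapping.lookup u (\<beta>, i0, Max I) \<noteq> 0"
      by (auto simp: I_def)
    have "Poly_Mapping.lookup (D2 u - scl (\<phi>2 \<beta>) u) (\<beta>, i', j') = 0" if "j' \<ge> Max I" for i' j'
    proof -
      have "Suc j' \<notin> I"
        using that Max_ge[OF I, of "Suc j'"] by auto
      then show ?thesis
        unfolding lookup by (simp add: I_def)
    qed
    then have "(\<beta>, i0, Max I) \<notin> down (D2 u - scl (\<phi>2 \<beta>) u)"
      by (auto simp: mem_down)
    moreover have "(\<beta>, i0, Max I) \<in> down u"
      using i0 by (auto simp: mem_down)
    moreover have "down (D2 u - scl (\<phi>2 \<beta>) u) \<subseteq> down u"
    proof clarify
      fix \<alpha> i j assume "(\<alpha>, i, j) \<in> down (D2 u - scl (\<phi>2 \<beta>) u)"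
      then obtain i' j' where ij: "i' \<ge> i" "j' \<ge> j" "Poly_Mapping.lookup (D2 u - scl (\<phi>2 \<beta>) u) (\<alpha>, i', j') \<noteq> 0"
        unfolding mem_down by blast
      then have "Poly_Mapping.lookup u (\<alpha>, i', j') \<noteq> 0 \<or> Poly_Mapping.lookup u (\<alpha>, i', Suc j') \<noteq> 0"
        unfolding lookup by auto
      then show "(\<alpha>, i, j) \<in> down u"
        using ij(1,2) unfolding mem_down by (meson le_Suc_eq)
    qed
    ultimately show "down (D2 u - scl (\<phi>2 \<beta>) u) \<subset> down u"
      by blast
  qed
  ultimately obtain \<gamma> c where c: "u = scl c (xmon \<gamma> 0 0)" "c \<noteq> 0"
    using eigenvector_monomial[of u "\<phi>1 \<beta>" "\<phi>2 \<beta>"] u(2) by (metis eq_iff_diff_eq_0)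
  \<comment> \<open>A nonzero multiple of a monomial with exponents 0 is a unit.\<close>
  have "scl (inverse c) (xmon (- \<gamma>) 0 0) * u \<in> S"
    using u(1) by (intro ideal A_closed)
  then show ?thesis
    using c by (simp add: scl_mult_left scl_mult_right xmon_mult xmon_zero)
qed

text \<open>On a monomial with exponents 0 the expression is that monomial times
  \<open>R \<beta>\<close>, which is affine in \<beta>. Differences of \<open>R\<close> yield its
  linear part, comparison with \<open>R\<close> itself yields \<open>\<epsilon> p\<close>, and an
  exponent 1 yields \<open>q\<close> or \<open>p\<close> alone. It is applied to \<open>D1 u\<close>
  and \<open>D2 u - \<epsilon> u\<close>, modulo 0 and modulo the ideal M.\<close>

lemma separation:
  assumes S: "alg.subspace S" and ideal: "\<And>a u. a \<in> A \<Longrightarrow> u \<in> S \<Longrightarrow> a * u \<in> S" and F: "small F"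
    and mem: "\<And>\<beta> i j. \<beta> \<notin> F \<Longrightarrow> i \<in> J1 \<Longrightarrow> j \<in> J2 \<Longrightarrow>
      p * (nabla2 (xmon \<beta> i j) - scl (\<epsilon> / 2) (xmon \<beta> i j)) - q * nabla1 (xmon \<beta> i j) \<in> S"
  shows "p \<in> S" "q \<in> S"
proof -
  note sub = alg.subspace_add[OF S] alg.subspace_diff[OF S] alg.subspace_scale[OF S] alg.subspace_neg[OF S]
  define R where "R \<beta> = scl (\<phi>2 \<beta> + \<phi>2 \<alpha>0 / 2 - \<epsilon> / 2) p - scl (\<phi>1 \<beta> + \<phi>1 \<alpha>0 / 2) q" for \<beta>
  have unscale: "v \<in> S" if "scl c v \<in> S" "c \<noteq> 0" for c v
    using sub(3)[OF that(1), of "inverse c"] that(2) by simp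
  have 0: "0 \<in> J1" "0 \<in> J2"
    using J1 J2 by auto
  have R: "R \<beta> \<in> S" if "\<beta> \<notin> F" for \<beta>
  proof -
    have "p * (nabla2 (xmon \<beta> 0 0) - scl (\<epsilon> / 2) (xmon \<beta> 0 0)) - q * nabla1 (xmon \<beta> 0 0) = xmon \<beta> 0 0 * R \<beta>"
      by (simp add: nabla_xmon R_def scl_def single_diff algebra_simps)
    then have "xmon (- \<beta>) 0 0 * (xmon \<beta> 0 0 * R \<beta>) \<in> S"
      using mem[OF that 0] by (metis A_closed(9) ideal)
    then show ?thesis
      by (simp add: xmon_uminus_mult)
  qed
  have a: "scl (\<phi>2 \<alpha>) p - scl (\<phi>1 \<alpha>) q \<in> S" for \<alpha>
  proof -
    \<comment> \<open>A base point at which both ends of the difference avoid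
      \<open>F\<close>.\<close>
    obtain \<beta> where "\<beta> \<notin> F \<union> (\<lambda>\<gamma>. \<gamma> - \<alpha>) ` F"
      using small_avoid[OF small_Un[OF F small_image[OF F]]] .
    then have "\<beta> \<notin> F" "\<beta> + \<alpha> \<notin> F"
      by (auto simp: image_iff)
    then have "R (\<beta> + \<alpha>) - R \<beta> \<in> S"
      by (intro sub R)
    moreover have "R (\<beta> + \<alpha>) - R \<beta> = scl (\<phi>2 \<alpha>) p - scl (\<phi>1 \<alpha>) q"
      by (simp add: R_def \<phi>_add scl_def single_diff single_add algebra_simps)
    ultimately show ?thesis
      by simp
  qed
  have b: "q \<in> S" if "J1 = UNIV"
  proof -
    have F: "F = {}"
      using F that small_UNIV by blast
    \<comment> \<open>Differentiating the exponent 1 leaves the extra term \<open>- q\<close> beside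
      the affine expression at weight 0.\<close>
    have "p * (nabla2 (xmon 0 1 0) - scl (\<epsilon> / 2) (xmon 0 1 0)) - q * nabla1 (xmon 0 1 0) = xmon 0 1 0 * R 0 - q"
      by (simp add: nabla_xmon R_def scl_def single_diff xmon_zero algebra_simps)
    then have "xmon 0 1 0 * R 0 - q \<in> S"
      using mem[of 0 1 0] that 0 F by simp
    moreover have "xmon 0 1 0 * R 0 \<in> S"
      using that 0 F by (intro ideal R xmon_carrier) auto
    ultimately have "xmon 0 1 0 * R 0 - (xmon 0 1 0 * R 0 - q) \<in> S"
      using sub(2) by blast
    then show ?thesis
      by (simp add: algebra_simps)
  qed
  have c: "p \<in> S" if "J2 = UNIV"
  proof -
    have F: "F = {}"
      using F that small_UNIV by blast
    have "p * (nabla2 (xmon 0 0 1) - scl (\<epsilon> / 2) (xmon 0 0 1)) - q * nabla1 (xmon 0 0 1) = xmon 0 0 1 * R 0 + p"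
      by (simp add: nabla_xmon R_def scl_def single_diff xmon_zero algebra_simps)
    then have "xmon 0 0 1 * R 0 + p \<in> S"
      using mem[of 0 0 1] that 0 F by simp
    moreover have "xmon 0 0 1 * R 0 \<in> S"
      using that 0 F by (intro ideal R xmon_carrier) auto
    ultimately have "xmon 0 0 1 * R 0 + p - xmon 0 0 1 * R 0 \<in> S"
      using sub(2) by blast
    then show ?thesis
      by simp
  qed
  have d: "scl \<epsilon> p \<in> S"
  proof -
    obtain \<beta> where "\<beta> \<notin> F"
      using small_avoid[OF F] .
    \<comment> \<open>\<open>2 R \<beta>\<close> equals the linear part at the weight
      \<open>\<alpha>0 + 2 \<beta>\<close> minus \<open>\<epsilon> p\<close>. Doubling avoids a half
      of \<alpha>0, which the group need not contain.\<close>
    then have "scl (\<phi>2 (\<alpha>0 + \<beta> + \<beta>)) p - scl (\<phi>1 (\<alpha>0 + \<beta> + \<beta>)) q - scl 2 (R \<beta>) \<in> S"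
      by (intro sub(2)[OF a sub(3)] R)
    moreover have "scl (\<phi>2 (\<alpha>0 + \<beta> + \<beta>)) p - scl (\<phi>1 (\<alpha>0 + \<beta> + \<beta>)) q - scl 2 (R \<beta>) = scl \<epsilon> p"
      by (rule poly_mapping_eqI) (simp add: R_def \<phi>_add lookup_scl lookup_minus lookup_add field_simps)
    ultimately show ?thesis
      by simp
  qed
  have "p \<in> S \<and> q \<in> S"
  proof (cases "\<epsilon> = 0")
    case True
    have "p \<in> S"
      using sep2[OF True]
    proof
      assume "\<exists>\<alpha>. \<phi>1 \<alpha> = 0 \<and> \<phi>2 \<alpha> \<noteq> 0"
      then obtain \<alpha> where "\<phi>1 \<alpha> = 0" "\<phi>2 \<alpha> \<noteq> 0"
        by blast
      then have "scl (\<phi>2 \<alpha>) p \<in> S"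
        using a[of \<alpha>] by simp
      then show ?thesis
        using \<open>\<phi>2 \<alpha> \<noteq> 0\<close> by (rule unscale)
    qed (rule c)
    moreover have "q \<in> S"
      using sep1[OF True]
    proof
      assume "\<exists>\<alpha>. \<phi>1 \<alpha> \<noteq> 0 \<and> \<phi>2 \<alpha> = 0"
      then obtain \<alpha> where "\<phi>2 \<alpha> = 0" "\<phi>1 \<alpha> \<noteq> 0"
        by blast
      then have "scl (\<phi>1 \<alpha>) q \<in> S"
        using sub(4)[OF a[of \<alpha>]] by simp
      then show ?thesis
        using \<open>\<phi>1 \<alpha> \<noteq> 0\<close> by (rule unscale)
    qed (rule b)
    ultimately show ?thesis ..
  next
    case False
    then have p: "p \<in> S"
      using d \<epsilon> by simp
    moreover have "q \<in> S"
      using nz1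
    proof
      assume "\<exists>\<alpha>. \<phi>1 \<alpha> \<noteq> 0"
      then obtain \<alpha> where "\<phi>1 \<alpha> \<noteq> 0"
        by blast
      have "scl (\<phi>2 \<alpha>) p - (scl (\<phi>2 \<alpha>) p - scl (\<phi>1 \<alpha>) q) \<in> S"
        by (intro sub(2)[OF sub(3) a] p)
      then have "scl (\<phi>1 \<alpha>) q \<in> S"
        by (simp add: algebra_simps)
      then show ?thesis
        using \<open>\<phi>1 \<alpha> \<noteq> 0\<close> by (rule unscale)
    qed (rule b)
    ultimately show ?thesis ..
  qed
  then show "p \<in> S" "q \<in> S"
    by simp_all
qed

text \<open>With the total weight \<gamma> fixed, the coefficient is affine in \<alpha>; it is
  arranged in the shape that \<open>affine_avoid\<close> handles.\<close>

lemma even_odd_monomials: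
  "EO (xmon \<alpha> 0 0) (xmon (\<gamma> - \<alpha>) 0 0) =
    scl ((\<phi>2 \<gamma> + \<phi>2 \<alpha>0 / 2 - 3 / 2 * \<epsilon>) * \<phi>1 \<alpha> + - (\<phi>1 \<gamma> + \<phi>1 \<alpha>0 / 2) * \<phi>2 \<alpha>
      + \<epsilon> * (\<phi>1 \<gamma> + \<phi>1 \<alpha>0 / 2)) (xmon \<gamma> 0 0)"
proof -
  have "EO (xmon \<alpha> 0 0) (xmon (\<gamma> - \<alpha>) 0 0) =
      scl (\<phi>1 \<alpha> * (\<phi>2 (\<gamma> - \<alpha>) + \<phi>2 \<alpha>0 / 2) - \<phi>2 \<alpha> * (\<phi>1 (\<gamma> - \<alpha>) + \<phi>1 \<alpha>0 / 2)
        + \<epsilon> * (\<phi>1 (\<gamma> - \<alpha>) + \<phi>1 \<alpha>0 / 2) - \<epsilon> / 2 * \<phi>1 \<alpha>) (xmon \<gamma> 0 0)"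
    unfolding even_odd_nabla
    by (simp add: nabla_xmon der1_xmon der2_xmon scl_mult_left scl_mult_right xmon_mult
        alg.scale_left_distrib alg.scale_left_diff_distrib alg.scale_right_distrib algebra_simps)
  also have "\<phi>1 \<alpha> * (\<phi>2 (\<gamma> - \<alpha>) + \<phi>2 \<alpha>0 / 2) - \<phi>2 \<alpha> * (\<phi>1 (\<gamma> - \<alpha>) + \<phi>1 \<alpha>0 / 2)
        + \<epsilon> * (\<phi>1 (\<gamma> - \<alpha>) + \<phi>1 \<alpha>0 / 2) - \<epsilon> / 2 * \<phi>1 \<alpha>
      = (\<phi>2 \<gamma> + \<phi>2 \<alpha>0 / 2 - 3 / 2 * \<epsilon>) * \<phi>1 \<alpha> + - (\<phi>1 \<gamma> + \<phi>1 \<alpha>0 / 2) * \<phi>2 \<alpha>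
        + \<epsilon> * (\<phi>1 \<gamma> + \<phi>1 \<alpha>0 / 2)"
    by (simp add: \<phi>_diff field_simps)
  finally show ?thesis .
qed

text \<open>Separation modulo the zero ideal, applied to the factored bracket.\<close>

lemma central_if_annihilates_B1:
  assumes "\<And>v. v \<in> B1 \<Longrightarrow> EO u v = 0"
  shows "D1 u = 0" "D2 u = scl \<epsilon> u"
proof -
  have mem: "D1 u * (nabla2 (xmon \<beta> i j) - scl (\<epsilon> / 2) (xmon \<beta> i j)) - (D2 u - scl \<epsilon> u) * nabla1 (xmon \<beta> i j) \<in> {0}"
    if "\<beta> \<notin> exceptional" "i \<in> J1" "j \<in> J2" for \<beta> i j
    using assms[OF xmon_in_B1[OF that]] unfolding even_odd_factored by simp
  have "alg.subspace {0 :: ('g, 'k) alg}"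
    by (simp add: alg.subspace_def)
  from separation[OF this _ small_exceptional mem] show "D1 u = 0" "D2 u = scl \<epsilon> u"
    by simp_all
qed

text \<open>Since \<gamma> is not exceptional, the affine coefficient of the bracket is not
  identically zero, so a suitable \<alpha> avoids \<open>F\<close>. The second property hides
  division by that coefficient.\<close>

lemma monomial_from_bracket:
  assumes "J1 = {0}" "J2 = {0}" "finite F" "\<gamma> \<notin> exceptional"
  obtains \<alpha> where "\<alpha> \<notin> F" "\<And>S. alg.subspace S \<Longrightarrow> EO (xmon \<alpha> 0 0) (xmon (\<gamma> - \<alpha>) 0 0) \<in> S \<Longrightarrow> xmon \<gamma> 0 0 \<in> S"
proof -
  define r where "r = \<phi>2 \<gamma> + \<phi>2 \<alpha>0 / 2 - 3 / 2 * \<epsilon>"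
  define s where "s = \<phi>1 \<gamma> + \<phi>1 \<alpha>0 / 2"
  have rs: "r \<noteq> 0 \<or> s \<noteq> 0"
    using assms(1,2,4) unfolding exceptional_def r_def s_def mem_Collect_eq by (metis eq_iff_diff_eq_0)
  have U: "J1 \<noteq> UNIV" "J2 \<noteq> UNIV"
    using assms(1,2) by (metis UNIV_I singletonD zero_neq_one)+
  \<comment> \<open>If \<open>s \<noteq> 0\<close> and \<epsilon> = 0, the constant term is gone and
    \<open>sep2\<close> gives a weight seen by \<open>\<phi>2\<close> alone. Otherwise
    \<open>\<phi>1 a \<noteq> 0\<close> suffices: either \<open>s = 0\<close> and
    \<open>r \<noteq> 0\<close>, or the constant \<open>\<epsilon> * s\<close> is nonzero.\<close>
  have "\<exists>a. a \<noteq> 0 \<and> (r * \<phi>1 a + - s * \<phi>2 a \<noteq> 0 \<or> \<epsilon> * s \<noteq> 0)"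
  proof (cases "s \<noteq> 0 \<and> \<epsilon> = 0")
    case True
    then obtain a where "\<phi>1 a = 0" "\<phi>2 a \<noteq> 0"
      using sep2 U by blast
    then show ?thesis
      using True by (intro exI[of _ a]) auto
  next
    case False
    obtain a where "\<phi>1 a \<noteq> 0"
      using nz1 U by blast
    then show ?thesis
      using False rs by (intro exI[of _ a]) auto
  qed
  then obtain a where "a \<noteq> 0" "r * \<phi>1 a + - s * \<phi>2 a \<noteq> 0 \<or> \<epsilon> * s \<noteq> 0"
    by blast
  then obtain \<alpha> where \<alpha>: "\<alpha> \<notin> F" "r * \<phi>1 \<alpha> + - s * \<phi>2 \<alpha> + \<epsilon> * s \<noteq> 0"
    using affine_avoid[OF assms(3)] by metis
  have "xmon \<gamma> 0 0 \<in> S" if "alg.subspace S" "EO (xmon \<alpha> 0 0) (xmon (\<gamma> - \<alpha>) 0 0) \<in> S" for S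
    using alg.subspace_scale[OF that, of "inverse (r * \<phi>1 \<alpha> + - s * \<phi>2 \<alpha> + \<epsilon> * s)"] \<alpha>(2)
    unfolding even_odd_monomials r_def[symmetric] s_def[symmetric] by simp
  with \<alpha>(1) show ?thesis
    using that by blast
qed

text \<open>Stated for the even and odd components of an ideal pulled back from the quotient;
  \<open>nontrivial\<close> says that it is more than the central part.\<close>

theorem ideal_full:
  assumes I0: "alg.subspace I0" and I1: "alg.subspace I1" and "I1 \<subseteq> B1"
    and odd_odd: "\<And>v w. v \<in> I1 \<Longrightarrow> w \<in> B1 \<Longrightarrow> t * v * w \<in> I0"
    and even_odd: "\<And>u v. u \<in> I0 \<Longrightarrow> v \<in> B1 \<Longrightarrow> EO u v \<in> I1"
    and nontrivial: "I1 \<noteq> {0} \<or> (\<exists>u\<in>I0. \<not> (D1 u = 0 \<and> D2 u = scl \<epsilon> u))"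
  shows "A \<subseteq> I0 \<and> B1 \<subseteq> I1"
proof -
  have "\<exists>w\<in>I1. w \<noteq> 0"
  proof (rule ccontr)
    assume "\<not> (\<exists>w\<in>I1. w \<noteq> 0)"
    then have zero: "w = 0" if "w \<in> I1" for w
      using that by blast
    then have "I1 = {0}"
      using alg.subspace_0[OF I1] by blast
    then obtain u where u: "u \<in> I0" "\<not> (D1 u = 0 \<and> D2 u = scl \<epsilon> u)"
      using nontrivial by blast
    have "EO u v = 0" if "v \<in> B1" for v
      using zero even_odd[OF u(1) that] by blast
    then show False
      using central_if_annihilates_B1[of u] u(2) by blast
  qed
  then obtain w where w: "w \<in> I1" "w \<noteq> 0"
    by blast
  \<comment> \<open>\<open>F\<close> records the weights lost through the gap in \<open>B1\<close>;
    it must be allowed to vary for M to be an ideal.\<close>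
  define absorbs where "absorbs F a \<longleftrightarrow> (\<forall>\<beta> i j. \<beta> \<notin> F \<longrightarrow> i \<in> J1 \<longrightarrow> j \<in> J2 \<longrightarrow> a * xmon \<beta> i j \<in> I0)" for F a
  have absorbsD: "a * xmon \<beta> i j \<in> I0" if "absorbs F a" "\<beta> \<notin> F" "i \<in> J1" "j \<in> J2" for F a \<beta> i j
    using that unfolding absorbs_def by blast
  define M where "M = {a \<in> A. \<exists>F. small F \<and> absorbs F a}"
  have MI: "a \<in> M" if "a \<in> A" "small F" "absorbs F a" for a F
    using that unfolding M_def by blast
  have ME: "\<exists>F. small F \<and> absorbs F a" "a \<in> A" if "a \<in> M" for a
    using that unfolding M_def by blast+
  have M: "alg.subspace M"
  proof (rule alg.subspaceI)
    show "0 \<in> M"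
      using alg.subspace_0[OF I0] by (intro MI[OF _ small_empty]) (simp_all add: A_closed absorbs_def)
  next
    fix a b assume ab: "a \<in> M" "b \<in> M"
    obtain F G where F: "small F" "absorbs F a" and G: "small G" "absorbs G b"
      using ME(1)[OF ab(1)] ME(1)[OF ab(2)] by blast
    have "absorbs (F \<union> G) (a + b)"
      using absorbsD[OF F(2)] absorbsD[OF G(2)] alg.subspace_add[OF I0]
      by (simp add: absorbs_def distrib_right)
    then show "a + b \<in> M"
      using ab ME(2) by (intro MI[OF _ small_Un[OF F(1) G(1)]] A_closed)
  next
    fix c a assume a: "a \<in> M"
    obtain F where F: "small F" "absorbs F a"
      using ME(1)[OF a] by blast
    have "absorbs F (scl c a)"
      using absorbsD[OF F(2)] alg.subspace_scale[OF I0] by (simp add: absorbs_def scl_mult_left)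
    then show "scl c a \<in> M"
      using a ME(2) by (intro MI[OF _ F(1)] A_closed)
  qed
  have ideal: "a * u \<in> M" if a: "a \<in> A" and u: "u \<in> M" for a u
  proof -
    obtain F where F: "small F" "absorbs F u"
      using ME(1)[OF u] by blast
    have "alg.subspace {a. a * u \<in> M}"
      using M by (auto simp: alg.subspace_def distrib_right scl_mult_left)
    moreover have "xmon \<alpha> i j * u \<in> M" if ij: "i \<in> J1" "j \<in> J2" for \<alpha> i j
    proof (rule MI[OF _ small_image[OF F(1)]])
      show "xmon \<alpha> i j * u \<in> A"
        using ij ME(2)[OF u] by (intro A_closed xmon_carrier)
      \<comment> \<open>Multiplication by a monomial of weight \<alpha> translates the bad weights
        by -\<alpha>.\<close>
      show "absorbs ((\<lambda>\<beta>. \<beta> - \<alpha>) ` F) (xmon \<alpha> i j * u)"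
        unfolding absorbs_def
      proof (intro allI impI)
        fix \<beta> k l assume \<beta>: "\<beta> \<notin> (\<lambda>\<beta>. \<beta> - \<alpha>) ` F" and kl: "k \<in> J1" "l \<in> J2"
        have "\<alpha> + \<beta> \<notin> F"
        proof
          assume "\<alpha> + \<beta> \<in> F"
          then have "(\<alpha> + \<beta>) - \<alpha> \<in> (\<lambda>\<beta>. \<beta> - \<alpha>) ` F"
            by (rule imageI)
          with \<beta> show False
            by simp
        qed
        moreover have "i + k \<in> J1" "j + l \<in> J2"
          using ij kl J1 J2 by auto
        ultimately have "u * xmon (\<alpha> + \<beta>) (i + k) (j + l) \<in> I0"
          by (rule absorbsD[OF F(2)])
        moreover have "u * xmon (\<alpha> + \<beta>) (i + k) (j + l) = xmon \<alpha> i j * u * xmon \<beta> k l"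
          by (simp add: xmon_mult[symmetric] mult_ac)
        ultimately show "xmon \<alpha> i j * u * xmon \<beta> k l \<in> I0"
          by simp
      qed
    qed
    ultimately have "A \<subseteq> {a. a * u \<in> M}"
      by (intro alg_carrier_subset_subspace) auto
    with a show ?thesis
      by blast
  qed
  have I1_M: "v \<in> M" if v: "v \<in> I1" for v
  proof (rule MI[OF _ small_image[OF small_exceptional]])
    show "v \<in> A"
      using v \<open>I1 \<subseteq> B1\<close> B1_subset_A by blast
    \<comment> \<open>The unit \<open>t\<close> in the odd bracket shifts weights by \<alpha>0: the
      odd partner has weight \<open>\<beta> - \<alpha>0\<close>.\<close>
    show "absorbs ((\<lambda>\<beta>. \<beta> + \<alpha>0) ` exceptional) v"
      unfolding absorbs_def
    proof (intro allI impI)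
      fix \<beta> i j assume \<beta>: "\<beta> \<notin> (\<lambda>\<beta>. \<beta> + \<alpha>0) ` exceptional" and ij: "i \<in> J1" "j \<in> J2"
      have "\<beta> - \<alpha>0 \<notin> exceptional"
        using \<beta> by (metis diff_add_cancel imageI)
      then have "t * v * xmon (\<beta> - \<alpha>0) i j \<in> I0"
        using ij by (intro odd_odd[OF v] xmon_in_B1)
      moreover have "t * v * xmon (\<beta> - \<alpha>0) i j = v * (t * xmon (\<beta> - \<alpha>0) i j)"
        by (simp only: mult_ac)
      ultimately show "v * xmon \<beta> i j \<in> I0"
        by (simp add: xmon_mult)
    qed
  qed
  have stable: "D1 u \<in> M \<and> D2 u \<in> M" if u: "u \<in> M" for u
  proof -
    obtain F where F: "small F" "absorbs F u"
      using ME(1)[OF u] by blast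
    obtain \<alpha> where \<alpha>: "\<alpha> \<notin> F"
      using small_avoid[OF F(1)] .
    \<comment> \<open>\<open>u\<close> itself need not lie in \<open>I0\<close>, so it cannot be
      bracketed yet. Multiplication by a unit of good weight moves it there, and the Leibniz rule
      transfers the result back.\<close>
    define u' where "u' = u * xmon \<alpha> 0 0"
    have u_eq: "u = xmon (- \<alpha>) 0 0 * u'"
      by (simp add: u'_def mult.commute[of u] xmon_uminus_mult)
    have 0: "0 \<in> J1" "0 \<in> J2"
      using J1 J2 by auto
    have "u' \<in> I0"
      unfolding u'_def by (rule absorbsD[OF F(2) \<alpha> 0])
    have "u' \<in> M"
      using ideal[OF A_closed(9) u] unfolding u'_def by (metis mult.commute)
    have mem: "D1 u' * (nabla2 (xmon \<beta> i j) - scl (\<epsilon> / 2) (xmon \<beta> i j)) - (D2 u' - scl \<epsilon> u') * nabla1 (xmon \<beta> i j) \<in> M"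
      if "\<beta> \<notin> exceptional" "i \<in> J1" "j \<in> J2" for \<beta> i j
      unfolding even_odd_factored[symmetric] by (rule I1_M[OF even_odd[OF \<open>u' \<in> I0\<close> xmon_in_B1[OF that]]])
    have "D1 u' \<in> M" "D2 u' - scl \<epsilon> u' \<in> M"
      using separation[OF M ideal small_exceptional mem] by blast+
    moreover from this(2) have "D2 u' \<in> M"
      using alg.subspace_add[OF M _ alg.subspace_scale[OF M \<open>u' \<in> M\<close>], of "D2 u' - scl \<epsilon> u'" \<epsilon>] by simp
    moreover have "D1 u = scl (\<phi>1 (- \<alpha>)) u + xmon (- \<alpha>) 0 0 * D1 u'" "D2 u = scl (\<phi>2 (- \<alpha>)) u + xmon (- \<alpha>) 0 0 * D2 u'"
      by (simp_all add: u_eq D_mult der1_xmon der2_xmon scl_mult_left)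
    ultimately show ?thesis
      using u by (auto intro!: alg.subspace_add[OF M] alg.subspace_scale[OF M] ideal A_closed)
  qed
  have "1 \<in> M"
    by (rule one_in_differential_ideal[OF M ideal _ _ I1_M[OF w(1)] w(2)]) (use stable in blast)+
  then obtain F where F: "small F" "absorbs F 1"
    using ME(1) by blast
  have mon: "xmon \<beta> i j \<in> I0" if "\<beta> \<notin> F" "i \<in> J1" "j \<in> J2" for \<beta> i j
    using absorbsD[OF F(2) that] by simp
  show ?thesis
  proof (cases "J1 = {0} \<and> J2 = {0}")
    case True
    then have J: "J1 = {0}" "J2 = {0}"
      by simp_all
    have 0: "0 \<in> J1" "0 \<in> J2"
      using J1 J2 by auto
    have "finite F" "finite exceptional"
      using F(1) small_exceptional unfolding small_def by (metis finite.emptyI)+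
    have "xmon \<gamma> 0 0 \<in> I1" if \<gamma>: "\<gamma> \<notin> exceptional" for \<gamma>
    proof -
      \<comment> \<open>Avoiding the first set puts the even factor in \<open>I0\<close>; avoiding
        the second puts the odd factor of weight \<open>\<gamma> - \<alpha>\<close> in
        \<open>B1\<close>.\<close>
      have "finite (F \<union> (\<lambda>\<kappa>. \<gamma> - \<kappa>) ` exceptional)"
        using \<open>finite F\<close> \<open>finite exceptional\<close> by simp
      then obtain \<alpha> where \<alpha>: "\<alpha> \<notin> F \<union> (\<lambda>\<kappa>. \<gamma> - \<kappa>) ` exceptional"
        and S: "\<And>S. alg.subspace S \<Longrightarrow> EO (xmon \<alpha> 0 0) (xmon (\<gamma> - \<alpha>) 0 0) \<in> S \<Longrightarrow> xmon \<gamma> 0 0 \<in> S"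
        using monomial_from_bracket[OF J _ \<gamma>] by metis
      have "\<gamma> - \<alpha> \<notin> exceptional"
      proof
        assume "\<gamma> - \<alpha> \<in> exceptional"
        then have "\<gamma> - (\<gamma> - \<alpha>) \<in> (\<lambda>\<kappa>. \<gamma> - \<kappa>) ` exceptional"
          by (rule imageI)
        with \<alpha> show False
          by simp
      qed
      then have "EO (xmon \<alpha> 0 0) (xmon (\<gamma> - \<alpha>) 0 0) \<in> I1"
        using \<alpha> 0 by (intro even_odd mon xmon_in_B1) blast+
      then show ?thesis
        by (rule S[OF I1])
    qed
    then have "regular \<subseteq> I1"
      using J by (intro regular_subset[OF I1]) (metis singletonD)
    then have "B1 \<subseteq> I1"
      by (simp only: B1_eq)
    moreover have "xmon \<gamma> 0 0 \<in> I0" for \<gamma>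
    proof -
      \<comment> \<open>An even monomial of any weight is \<open>t\<close> times two odd monomials,
        and both of their weights can be kept off the gap.\<close>
      obtain \<beta> where \<beta>: "\<beta> \<notin> exceptional \<union> (\<lambda>\<kappa>. \<gamma> - \<alpha>0 - \<kappa>) ` exceptional"
        using small_avoid[OF small_Un[OF small_exceptional small_image[OF small_exceptional]]] .
      have "\<gamma> - \<alpha>0 - \<beta> \<notin> exceptional"
      proof
        assume "\<gamma> - \<alpha>0 - \<beta> \<in> exceptional"
        then have "\<gamma> - \<alpha>0 - (\<gamma> - \<alpha>0 - \<beta>) \<in> (\<lambda>\<kappa>. \<gamma> - \<alpha>0 - \<kappa>) ` exceptional"
          by (rule imageI)
        with \<beta> show False
          by simp
      qed
      then have "xmon \<beta> 0 0 \<in> I1" "xmon (\<gamma> - \<alpha>0 - \<beta>) 0 0 \<in> B1"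
        using \<beta> 0 \<open>B1 \<subseteq> I1\<close> xmon_in_B1[of _ 0 0] by blast+
      from odd_odd[OF this] show ?thesis
        by (simp add: xmon_mult)
    qed
    then have "A \<subseteq> I0"
      using J by (intro alg_carrier_subset_subspace[OF I0]) (metis singletonD)
    ultimately show ?thesis
      by simp
  next
    case False
    \<comment> \<open>A polynomial variable leaves no bad weights: all monomials already lie in
      \<open>I0\<close>, and \<open>B1\<close> is spanned by brackets with
      \<open>I0 = A\<close>.\<close>
    then have "F = {}" "exceptional = {}"
      using F(1) by (auto simp: small_def exceptional_def)
    then have "A \<subseteq> I0" "A = B1"
      using mon by (auto simp: B1_eq regular_def intro!: alg_carrier_subset_subspace[OF I0])
    moreover from this have "{EO u v |u v. u \<in> A \<and> v \<in> A} \<subseteq> I1"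
      using even_odd by blast
    then have "B1 \<subseteq> I1"
      unfolding B1_def by (rule alg.span_minimal[OF _ I1])
    ultimately show ?thesis
      by simp
  qed
qed

section \<open>Simplicity and codimension\<close>

lemma A_tilde_eq: "A_tilde J1 J2 \<phi>1 \<phi>2 \<alpha>0 \<epsilon> = with_odd_part A"
  by (simp add: A_tilde_def with_odd_part_def)

lemma B_tilde_odd_eq: "B_tilde_odd J1 J2 \<phi>1 \<phi>2 \<alpha>0 \<epsilon> = {0} \<times> B1"
proof -
  define G where "G = {a \<otimes>\<^bsub>with_odd_part A\<^esub> b |a b. a \<in> grade (with_odd_part A) False \<and> b \<in> grade (with_odd_part A) True}"
  have G: "G = {(0, EO u v) |u v. u \<in> A \<and> v \<in> A}"
    unfolding G_def by (auto 0 3)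
  have "(\<lambda>H. submodule H ring_of_type_algebra (with_odd_part A)) hull G = {0} \<times> B1"
  proof (rule hull_unique)
    show "G \<subseteq> {0} \<times> B1"
      unfolding G using EO_in_B1 by auto
    show "submodule ({0} \<times> B1) ring_of_type_algebra (with_odd_part A)"
      unfolding submodule_with_odd_part[OF subspace_alg_carrier]
      using B1_subset_A alg.subspace_0[OF subspace_B1] alg.subspace_add[OF subspace_B1] alg.subspace_scale[OF subspace_B1]
      by (auto simp: A_closed zero_prod_def)
    fix H assume "G \<subseteq> H" and "submodule H ring_of_type_algebra (with_odd_part A)"
    then have H: "0 \<in> H" "\<And>x y. x \<in> H \<Longrightarrow> y \<in> H \<Longrightarrow> x + y \<in> H" "\<And>c u v. (u, v) \<in> H \<Longrightarrow> (scl c u, scl c v) \<in> H"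
      unfolding submodule_with_odd_part[OF subspace_alg_carrier] by blast+
    have "B1 \<subseteq> {v. (0, v) \<in> H}"
      unfolding B1_def
    proof (rule alg.span_minimal)
      show "{EO u v |u v. u \<in> A \<and> v \<in> A} \<subseteq> {v. (0, v) \<in> H}"
        using \<open>G \<subseteq> H\<close> unfolding G by blast
      show "alg.subspace {v. (0, v) \<in> H}"
        using H(1) H(2)[of "(0, _)" "(0, _)"] H(3)[of 0] unfolding alg.subspace_def by (simp add: zero_prod_def)
    qed
    then show "{0} \<times> B1 \<subseteq> H"
      by auto
  qed
  then show ?thesis
    unfolding B_tilde_odd_def Let_def A_tilde_eq lin_span_def G_def .
qed

lemma B_tilde_eq: "B_tilde J1 J2 \<phi>1 \<phi>2 \<alpha>0 \<epsilon> = with_odd_part B1"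
proof -
  have "A \<times> {0} <+>\<^bsub>with_odd_part A\<^esub> {0} \<times> B1 = A \<times> B1"
    using alg.subspace_0[OF subspace_B1] by (auto simp: set_add_def' A_closed)
  then have "B_tilde J1 J2 \<phi>1 \<phi>2 \<alpha>0 \<epsilon> = with_odd_part A
      \<lparr>carrier := A \<times> B1, grade := \<lambda>i. if i then {0} \<times> B1 else A \<times> {0}\<rparr>"
    unfolding B_tilde_def Let_def A_tilde_eq B_tilde_odd_eq by (simp cong: if_cong)
  then show ?thesis
    by (simp add: with_odd_part_def)
qed

theorem codimension_le_1:
  "codimension ring_of_type_algebra (A_tilde J1 J2 \<phi>1 \<phi>2 \<alpha>0 \<epsilon>) (carrier (B_tilde J1 J2 \<phi>1 \<phi>2 \<alpha>0 \<epsilon>)) \<le> 1"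
proof -
  define L where "L = with_odd_part A"
  note L = with_odd_part_simps[of A, folded L_def]
  have sub: "submodule (A \<times> B1) ring_of_type_algebra L"
    unfolding L_def submodule_with_odd_part[OF subspace_alg_carrier]
    using B1_subset_A alg.subspace_0[OF subspace_B1] alg.subspace_add[OF subspace_B1] alg.subspace_scale[OF subspace_B1]
    by (auto simp: A_closed zero_prod_def)
  have "Module.module ring_of_type_algebra L"
    unfolding L_def by (rule module_with_odd_part[OF subspace_alg_carrier])
  then interpret quotient_module ring_of_type_algebra L "A \<times> B1"
    using sub by (rule quotient_module.intro)
  interpret Q: Module.module ring_of_type_algebra "quotient_superalgebra L (A \<times> B1)"
    by (rule module_quotient)
  \<comment> \<open>The class of \<open>x\<close> is to span the quotient: \<open>x\<close> is the
    missing monomial, or 0 if none is missing.\<close>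
  obtain x where x: "x \<in> A" "\<And>v. v \<in> A \<Longrightarrow> \<exists>c. v - scl c x \<in> B1"
  proof (cases "exceptional = {}")
    case True
    then have "A = B1"
      by (auto simp: B1_eq regular_def)
    then show ?thesis
      using that[of 0] A_closed(10) by simp
  next
    case False
    then obtain \<gamma> where \<gamma>: "\<gamma> \<in> exceptional"
      by blast
    have "v - scl (Poly_Mapping.lookup v (\<gamma>, 0, 0)) (xmon \<gamma> 0 0) \<in> B1" if "v \<in> A" for v
      using that exceptional_unique[OF \<gamma>] unfolding B1_eq regular_def
      by (auto simp: A_closed lookup_minus lookup_scl lookup_xmon)
    then show ?thesis
      using that[of "xmon \<gamma> 0 0"] by (metis A_closed(9))
  qed
  have "lin_span ring_of_type_algebra (quotient_superalgebra L (A \<times> B1)) {cls (0, x)} =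
      carrier (quotient_superalgebra L (A \<times> B1))"
    unfolding lin_span_def
  proof (rule hull_unique)
    show "{cls (0, x)} \<subseteq> carrier (quotient_superalgebra L (A \<times> B1))"
      using x(1) by (auto simp: carrier_quotient L A_closed)
    show "submodule (carrier (quotient_superalgebra L (A \<times> B1))) ring_of_type_algebra (quotient_superalgebra L (A \<times> B1))"
      by (rule Q.carrier_is_submodule)
    fix H assume "{cls (0, x)} \<subseteq> H" and H: "submodule H ring_of_type_algebra (quotient_superalgebra L (A \<times> B1))"
    then have xH: "cls (0, x) \<in> H"
      by simp
    show "carrier (quotient_superalgebra L (A \<times> B1)) \<subseteq> H"
    proof
      fix S assume "S \<in> carrier (quotient_superalgebra L (A \<times> B1))"
      then obtain u v where S: "S = cls (u, v)" and uv: "u \<in> A" "v \<in> A"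
        by (auto simp: carrier_quotient L)
      obtain c where c: "v - scl c x \<in> B1"
        using x(2)[OF uv(2)] by blast
      have "cls (u, v) = cls (0, scl c x)"
        by (rule cls_eqI[where h = "(u, v - scl c x)"]) (use x(1) uv c in \<open>auto simp: L A_closed\<close>)
      also have "\<dots> = c \<odot>\<^bsub>quotient_superalgebra L (A \<times> B1)\<^esub> cls (0, x)"
        using x(1) smult_quotient[of c "(0, x)"] by (simp add: L A_closed)
      also have "\<dots> \<in> H"
        using Q.submoduleE(4)[OF H _ xH] by simp
      finally show "S \<in> H"
        unfolding S .
    qed
  qed
  then have "lin_dim ring_of_type_algebra (quotient_superalgebra L (A \<times> B1)) \<le> enat (card {cls (0, x)})"
    unfolding lin_dim_def using x(1)
    by (intro Inf_lower) (auto simp: carrier_quotient L A_closed intro!: exI[of _ "{cls (0, x)}"])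
  then show ?thesis
    by (simp add: codimension_def A_tilde_eq B_tilde_eq L_def one_enat_def)
qed

text \<open>Joint eigenvectors for 0 and \<epsilon> are multiples of the monomial whose weight
  satisfies \<open>\<phi>1 \<sigma> = 0\<close> and \<open>\<phi>2 \<sigma> = \<epsilon>\<close>.
  This treats both quotients at once: the weight is 0 for \<epsilon> = 0 and \<sigma>1 for
  \<epsilon> = 1; without such a weight, \<open>z = 0\<close>.\<close>

lemma central_elem:
  obtains z where "central_elem \<phi>1 \<phi>2 \<epsilon> = (z, 0)" "z \<in> A" "D1 z = 0" "D2 z = scl \<epsilon> z"
    "\<And>u. D1 u = 0 \<Longrightarrow> D2 u = scl \<epsilon> u \<Longrightarrow> \<exists>c. u = scl c z"
proof -
  have uniq: "\<sigma> = \<sigma>'" if "\<phi>1 \<sigma> = 0" "\<phi>2 \<sigma> = \<epsilon>" "\<phi>1 \<sigma>' = 0" "\<phi>2 \<sigma>' = \<epsilon>" for \<sigma> \<sigma>'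
    using ker[of "\<sigma> - \<sigma>'"] that by (simp add: \<phi>_diff)
  show ?thesis
  proof (cases "\<exists>\<sigma>. \<phi>1 \<sigma> = 0 \<and> \<phi>2 \<sigma> = \<epsilon>")
    case True
    then obtain \<sigma> where \<sigma>: "\<phi>1 \<sigma> = 0" "\<phi>2 \<sigma> = \<epsilon>"
      by blast
    have "central_elem \<phi>1 \<phi>2 \<epsilon> = (xmon \<sigma> 0 0, 0)"
    proof (cases "\<epsilon> = 0")
      case True
      then have "\<sigma> = 0"
        using \<sigma> by (intro ker) simp_all
      then show ?thesis
        using True by (simp add: central_elem_def)
    next
      case False
      then have \<epsilon>1: "\<epsilon> = 1"
        using \<epsilon> by simp
      have "(THE \<sigma>. \<phi>1 \<sigma> = 0 \<and> \<phi>2 \<sigma> = 1) = \<sigma>"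
        using uniq[OF _ _ \<sigma>] \<sigma> unfolding \<epsilon>1 by (intro the_equality) blast+
      then show ?thesis
        using \<epsilon>1 \<sigma> by (auto simp: central_elem_def x_sigma1_def)
    qed
    moreover have "\<exists>c. u = scl c (xmon \<sigma> 0 0)" if u: "D1 u = 0" "D2 u = scl \<epsilon> u" for u
    proof (cases "u = 0")
      case True
      then show ?thesis
        by (intro exI[of _ 0]) simp
    next
      case False
      have "D1 u = scl 0 u"
        using u(1) by simp
      then obtain \<beta> c where "u = scl c (xmon \<beta> 0 0)" "\<phi>1 \<beta> = 0" "\<phi>2 \<beta> = \<epsilon>"
        using eigenvector_monomial[OF _ u(2) False] by metis
      then show ?thesis
        using uniq[OF _ _ \<sigma>] by blast
    qed
    ultimately show ?thesis
      using \<sigma> by (intro that[of "xmon \<sigma> 0 0"]) (simp_all add: A_closed der1_xmon der2_xmon)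
  next
    case no_\<sigma>: False
    have "\<epsilon> \<noteq> 0"
      using no_\<sigma> \<phi>_zero by metis
    then have "central_elem \<phi>1 \<phi>2 \<epsilon> = (0, 0)"
      using no_\<sigma> \<epsilon> by (auto simp: central_elem_def x_sigma1_def)
    moreover have "u = 0" if u: "D1 u = 0" "D2 u = scl \<epsilon> u" for u
    proof (rule ccontr)
      assume "u \<noteq> 0"
      have "D1 u = scl 0 u"
        using u(1) by simp
      then show False
        using eigenvector_monomial[OF _ u(2) \<open>u \<noteq> 0\<close>] no_\<sigma> by metis
    qed
    ultimately show ?thesis
      by (intro that[of 0]) (simp_all add: A_closed)
  qed
qed

theorem simple_C_tilde:
  "simple_lie_superalgebra ring_of_type_algebra (C_tilde J1 J2 \<phi>1 \<phi>2 \<alpha>0 \<epsilon>)"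
proof -
  obtain z where z: "central_elem \<phi>1 \<phi>2 \<epsilon> = (z, 0)" "z \<in> A" "D1 z = 0" "D2 z = scl \<epsilon> z"
    "\<And>u. D1 u = 0 \<Longrightarrow> D2 u = scl \<epsilon> u \<Longrightarrow> \<exists>c. u = scl c z"
    using central_elem by metis
  define Z where "Z = range (\<lambda>c. (scl c z, 0 :: ('g, 'k) alg))"
  define L where "L = with_odd_part B1"
  note L = with_odd_part_simps[of B1, folded L_def]
  note sub = alg.subspace_0[OF subspace_B1] alg.subspace_add[OF subspace_B1] alg.subspace_scale[OF subspace_B1]
  have C: "C_tilde J1 J2 \<phi>1 \<phi>2 \<alpha>0 \<epsilon> = quotient_superalgebra L Z"
  proof -
    have "{c \<odot>\<^bsub>L\<^esub> (z, 0) |c. True} = Z"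
      by (auto simp: Z_def L)
    then show ?thesis
      by (simp add: C_tilde_def Let_def B_tilde_eq z(1) L_def)
  qed
  \<comment> \<open>\<open>D1 z = 0\<close> and \<open>D2 z = \<epsilon> z\<close> annihilate both
    factors in the factored bracket and make the even bracket cancel.\<close>
  have z0: "EE (scl c z) u = 0" "EE u (scl c z) = 0" "EO (scl c z) u = 0" for c u
  proof -
    have "EE z u = 0" for u
      using z(3,4) by (simp add: even_even_alt scl_mult_left)
    then show "EE (scl c z) u = 0" "EE u (scl c z) = 0"
      using even_even_skew[of u z] by (simp_all add: bracket_linear)
    show "EO (scl c z) u = 0"
      using z(3,4) by (simp add: even_odd_factored D_linear mult.commute)
  qed
  have ideal: "graded_ideal ring_of_type_algebra Z L"
    unfolding graded_ideal_def
  proof (intro conjI)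
    show "submodule Z ring_of_type_algebra L"
      unfolding L_def submodule_with_odd_part[OF subspace_B1]
    proof (intro conjI ballI allI)
      show "Z \<subseteq> A \<times> B1"
        using z(2) sub(1) by (auto simp: Z_def A_closed)
      show "0 \<in> Z"
        unfolding Z_def by (rule image_eqI[of _ _ 0]) (simp_all add: zero_prod_def)
      show "x + y \<in> Z" if xy: "x \<in> Z" "y \<in> Z" for x y
      proof -
        obtain c d where "x = (scl c z, 0)" "y = (scl d z, 0)"
          using xy unfolding Z_def by blast
        then show ?thesis
          unfolding Z_def by (intro image_eqI[of _ _ "c + d"]) (simp_all add: alg.scale_left_distrib)
      qed
      show "case x of (u, v) \<Rightarrow> (scl c u, scl c v) \<in> Z" if x: "x \<in> Z" for c x
      proof -
        obtain d where "x = (scl d z, 0)"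
          using x unfolding Z_def by blast
        then show ?thesis
          unfolding Z_def by (auto intro!: image_eqI[of _ _ "c * d"])
      qed
    qed
    have "Z \<inter> A \<times> {0} = Z" "Z \<inter> {0} \<times> B1 = {0}"
      using z(2) sub(1) by (auto simp: Z_def A_closed zero_prod_def intro: image_eqI[of _ _ 0])
    then show "Z = (Z \<inter> grade L False) <+>\<^bsub>L\<^esub> (Z \<inter> grade L True)"
      by (simp add: L set_add_def')
    have "0 \<in> Z"
      unfolding Z_def by (rule image_eqI[of _ _ 0]) (simp_all add: zero_prod_def)
    then show "\<forall>a\<in>carrier L. \<forall>x\<in>Z. a \<otimes>\<^bsub>L\<^esub> x \<in> Z \<and> x \<otimes>\<^bsub>L\<^esub> a \<in> Z"
      by (auto simp: L Z_def superbracket_def z0 zero_prod_def)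
  qed
  have lie: "lie_superalgebra ring_of_type_algebra L"
    unfolding L_def using subspace_B1 B1_subset_A EO_in_B1
    by (intro lie_superalgebra_with_odd_part) blast+
  interpret quotient_lie_superalgebra ring_of_type_algebra L Z
    using lie ideal by (intro quotient_lie_superalgebra.intro quotient_lie_superalgebra_axioms.intro)
  let ?C = "quotient_superalgebra L Z"
  interpret Q: Module.module ring_of_type_algebra ?C
    by (rule module_quotient)
  have odd_Z: "v = 0" if "(u, v) \<in> Z" for u v
    using that by (auto simp: Z_def)
  have carrier: "(u, v) \<in> carrier L \<longleftrightarrow> u \<in> A \<and> v \<in> B1" for u v
    by (simp add: L)
  have 0: "0 \<in> A" "0 \<in> B1"
    using sub(1) by (simp_all add: A_closed)
  have nonabelian: "\<exists>x\<in>carrier ?C. \<exists>y\<in>carrier ?C. x \<otimes>\<^bsub>?C\<^esub> y \<noteq> \<zero>\<^bsub>?C\<^esub>"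
  proof (rule ccontr)
    \<comment> \<open>As \<open>Z\<close> has no odd part, an abelian quotient forces
      \<open>EO\<close> to vanish and hence \<open>D1 = 0\<close> on \<open>A\<close>, against
      \<open>nz1\<close>.\<close>
    assume *: "\<not> ?thesis"
    have "EO u v = 0" if uv: "u \<in> A" "v \<in> B1" for u v
    proof -
      have c: "(u, 0) \<in> carrier L" "(0, v) \<in> carrier L" "(0, EO u v) \<in> carrier L"
        using uv 0 EO_in_B1 B1_subset_A unfolding carrier by blast+
      have "cls (u, 0) \<in> carrier ?C" "cls (0, v) \<in> carrier ?C"
        unfolding carrier_quotient by (intro imageI c)+
      then have "cls (u, 0) \<otimes>\<^bsub>?C\<^esub> cls (0, v) = Z"
        using * unfolding zero_quotient by blast
      moreover have "(u, 0) \<otimes>\<^bsub>L\<^esub> (0, v) = (0, EO u v)"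
        by (simp add: L)
      ultimately have "(0, EO u v) \<in> Z"
        using mult_quotient[OF c(1,2)] cls_eq_self_iff[OF c(3)] by simp
      then show ?thesis
        by (rule odd_Z)
    qed
    then have D1: "D1 u = 0" if "u \<in> A" for u
      using central_if_annihilates_B1(1) that by blast
    show False
      using nz1
    proof
      assume "J1 = UNIV"
      then have "xmon 0 1 0 \<in> A"
        using J2 by (intro xmon_carrier) auto
      from D1[OF this] show False
        by (simp add: der1_xmon xmon_zero)
    next
      assume "\<exists>\<alpha>. \<phi>1 \<alpha> \<noteq> 0"
      then obtain \<alpha> where "\<phi>1 \<alpha> \<noteq> 0"
        by blast
      with arg_cong[OF D1[OF A_closed(9)], of "\<lambda>u. Poly_Mapping.lookup u (\<alpha>, 0, 0)" \<alpha>] show False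
        by (simp add: der1_xmon lookup_scl lookup_xmon)
    qed
  qed
  have "I = carrier ?C" if I: "graded_ideal ring_of_type_algebra I ?C" and "I \<noteq> {\<zero>\<^bsub>?C\<^esub>}" for I
  proof -
    have subI: "submodule I ring_of_type_algebra ?C"
      and sumI: "I = (I \<inter> grade ?C False) <+>\<^bsub>?C\<^esub> (I \<inter> grade ?C True)"
      and idI: "\<And>a x. a \<in> carrier ?C \<Longrightarrow> x \<in> I \<Longrightarrow> a \<otimes>\<^bsub>?C\<^esub> x \<in> I" "\<And>a x. a \<in> carrier ?C \<Longrightarrow> x \<in> I \<Longrightarrow> x \<otimes>\<^bsub>?C\<^esub> a \<in> I"
      using I unfolding graded_ideal_def by blast+
    have zeroI: "Z \<in> I"
      using subgroup.one_closed[OF submodule.axioms(1)[OF subI]] by (simp add: zero_quotient)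
    have addI: "cls (x + y) \<in> I" if "cls x \<in> I" "cls y \<in> I" "x \<in> carrier L" "y \<in> carrier L" for x y
      using Q.submoduleE(5)[OF subI that(1,2)] add_quotient[OF that(3,4)] by (simp add: L)
    have smultI: "cls (scl c u, scl c v) \<in> I" if "cls (u, v) \<in> I" "(u, v) \<in> carrier L" for c u v
      using Q.submoduleE(4)[OF subI _ that(1), of c] smult_quotient[OF _ that(2), of c] by (simp add: L)
    have clsZ: "cls 0 = Z"
      using cls_in[OF N.zero_closed] by (simp add: L)
    \<comment> \<open>Working with representatives in \<open>A\<close> and \<open>B1\<close> makes
      the quotient disappear from the ideal argument.\<close>
    define I0 where "I0 = {u \<in> A. cls (u, 0) \<in> I}"
    define I1 where "I1 = {v \<in> B1. cls (0, v) \<in> I}"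
    have "A \<subseteq> I0 \<and> B1 \<subseteq> I1"
    proof (rule ideal_full)
      show "alg.subspace I0"
      proof (rule alg.subspaceI)
        show "0 \<in> I0"
          using zeroI clsZ 0 by (simp add: I0_def zero_prod_def)
        show "u + v \<in> I0" if "u \<in> I0" "v \<in> I0" for u v
          using addI[of "(u, 0)" "(v, 0)"] that 0 by (simp add: I0_def carrier A_closed)
        show "scl c u \<in> I0" if "u \<in> I0" for c u
          using smultI[of u 0 c] that 0 by (simp add: I0_def carrier A_closed)
      qed
      show "alg.subspace I1"
      proof (rule alg.subspaceI)
        show "0 \<in> I1"
          using zeroI clsZ 0 by (simp add: I1_def zero_prod_def)
        show "u + v \<in> I1" if "u \<in> I1" "v \<in> I1" for u v
          using addI[of "(0, u)" "(0, v)"] that 0 by (simp add: I1_def carrier sub)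
        show "scl c u \<in> I1" if "u \<in> I1" for c u
          using smultI[of 0 u c] that 0 by (simp add: I1_def carrier sub)
      qed
      show "I1 \<subseteq> B1"
        by (auto simp: I1_def)
      show "t * v * w \<in> I0" if vw: "v \<in> I1" "w \<in> B1" for v w
      proof -
        have "cls (0, v) \<otimes>\<^bsub>?C\<^esub> cls (0, w) \<in> I"
          using vw 0 by (intro idI) (auto simp: I1_def carrier_quotient carrier)
        moreover have "cls (0, v) \<otimes>\<^bsub>?C\<^esub> cls (0, w) = cls (t * v * w, 0)"
          using vw 0 by (subst mult_quotient) (simp_all add: carrier I1_def, simp add: L)
        moreover have "t * v * w \<in> A"
          using vw B1_subset_A by (intro A_closed) (auto simp: I1_def)
        ultimately show ?thesis
          by (simp add: I0_def)
      qed
      show "EO u v \<in> I1" if uv: "u \<in> I0" "v \<in> B1" for u v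
      proof -
        have "cls (u, 0) \<otimes>\<^bsub>?C\<^esub> cls (0, v) \<in> I"
          using uv 0 by (intro idI) (auto simp: I0_def carrier_quotient carrier)
        moreover have "cls (u, 0) \<otimes>\<^bsub>?C\<^esub> cls (0, v) = cls (0, EO u v)"
          using uv 0 by (subst mult_quotient) (simp_all add: carrier I0_def, simp add: L)
        moreover have "EO u v \<in> B1"
          using uv B1_subset_A by (intro EO_in_B1) (auto simp: I0_def)
        ultimately show ?thesis
          by (simp add: I1_def)
      qed
      obtain S where S: "S \<in> I" "S \<noteq> Z"
        using \<open>I \<noteq> {\<zero>\<^bsub>?C\<^esub>}\<close> zeroI unfolding zero_quotient by blast
      then obtain S0 S1 where S01: "S = S0 \<oplus>\<^bsub>?C\<^esub> S1" "S0 \<in> I" "S0 \<in> grade ?C False" "S1 \<in> I" "S1 \<in> grade ?C True"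
        using sumI unfolding set_add_def' by blast
      obtain u where u: "S0 = cls (u, 0)" "u \<in> A"
        using S01(3) unfolding grade_quotient L by auto
      obtain v where v: "S1 = cls (0, v)" "v \<in> B1"
        using S01(5) unfolding grade_quotient L by auto
      have S_uv: "S = cls (u, v)"
        using add_quotient[of "(u, 0)" "(0, v)"] u v 0 by (simp add: S01(1) carrier L(4))
      have "u \<in> I0" "v \<in> I1"
        using u v S01 by (simp_all add: I0_def I1_def)
      \<comment> \<open>A class with zero odd part and central even part is the zero class, contrary
        to the choice of \<open>S\<close>.\<close>
      moreover have False if central: "v = 0" "D1 u = 0" "D2 u = scl \<epsilon> u"
      proof -
        obtain c where "u = scl c z"
          using z(5)[OF central(2,3)] by blast
        then have "(u, v) \<in> Z"
          using central(1) by (auto simp: Z_def)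
        then show False
          using S(2) S_uv cls_in by simp
      qed
      ultimately show "I1 \<noteq> {0} \<or> (\<exists>u\<in>I0. \<not> (D1 u = 0 \<and> D2 u = scl \<epsilon> u))"
        by blast
    qed
    then have full: "cls (u, 0) \<in> I" "cls (0, v) \<in> I" if "u \<in> A" "v \<in> B1" for u v
      using that by (auto simp: I0_def I1_def)
    have "carrier ?C \<subseteq> I"
    proof
      fix S assume "S \<in> carrier ?C"
      then obtain u v where uv: "S = cls (u, v)" "u \<in> A" "v \<in> B1"
        unfolding carrier_quotient L by auto
      then show "S \<in> I"
        using addI[OF full[OF uv(2,3)]] 0 by (simp add: carrier)
    qed
    then show ?thesis
      using Q.submoduleE(1)[OF subI] by blast
  qed
  then show ?thesis
    unfolding simple_lie_superalgebra_def C using lie_superalgebra_quotient nonabelian by blast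
qed

end

theorem theorem3:
  fixes \<phi>1 \<phi>2 :: "'g::ab_group_add \<Rightarrow> 'k::field_char_0"
    and \<alpha>0 :: 'g and \<epsilon> :: 'k and J1 J2 :: "nat set"
  assumes torsion_free: "\<And>(n::nat) (a::'g). n > 0 \<Longrightarrow> (\<Sum>i<n. a) = 0 \<Longrightarrow> a = 0"
    and \<epsilon>: "\<epsilon> \<in> {0, 1}"
    and J1: "J1 \<in> {{0}, UNIV}"
    and J2: "J2 \<in> {{0}, UNIV}"
    and \<phi>1: "additive \<phi>1"
    and \<phi>2: "additive \<phi>2"
    and ker: "\<phi>1 -` {0} \<inter> \<phi>2 -` {0} = {0}"
    and nz1: "J1 = {0} \<Longrightarrow> \<phi>1 \<noteq> (\<lambda>_. 0)"
    and nz2: "\<epsilon> = 0 \<Longrightarrow> J2 = {0} \<Longrightarrow> \<phi>2 \<noteq> (\<lambda>_. 0)"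
  shows "(\<epsilon> = 1 \<or> (\<epsilon> = 0 \<and> \<alpha>0 \<noteq> 0 \<and> kernel_condition \<phi>1 \<phi>2) \<longrightarrow>
            simple_lie_superalgebra ring_of_type_algebra (C_tilde J1 J2 \<phi>1 \<phi>2 \<alpha>0 \<epsilon>)) \<and>
         (kernel_condition \<phi>1 \<phi>2 \<longrightarrow>
            codimension ring_of_type_algebra (A_tilde J1 J2 \<phi>1 \<phi>2 \<alpha>0 \<epsilon>)
              (carrier (B_tilde J1 J2 \<phi>1 \<phi>2 \<alpha>0 \<epsilon>)) \<le> 1)"
proof -
  \<comment> \<open>For \<epsilon> = 1 the assumptions \<open>sep1\<close> and \<open>sep2\<close>
    are vacuous. For \<epsilon> = 0 they follow from the kernel condition, because an index set
    \<open>{0}\<close> forces the corresponding homomorphism to be nonzero.\<close>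
  have "nondegenerate_contact_bracket \<phi>1 \<phi>2 \<epsilon> J1 J2" if cond: "\<epsilon> = 1 \<or> kernel_condition \<phi>1 \<phi>2"
  proof
    show "\<alpha> = 0" if "\<phi>1 \<alpha> = 0" "\<phi>2 \<alpha> = 0" for \<alpha>
      using ker that by blast
    show "\<epsilon> = 0 \<or> \<epsilon> = 1"
      using \<epsilon> by blast
    show "J1 = UNIV \<or> (\<exists>\<alpha>. \<phi>1 \<alpha> \<noteq> 0)"
      using J1 nz1 by blast
    show "J1 = UNIV \<or> (\<exists>\<alpha>. \<phi>1 \<alpha> \<noteq> 0 \<and> \<phi>2 \<alpha> = 0)" if "\<epsilon> = 0"
      using J1 nz1 cond that unfolding kernel_condition_def by auto
    show "J2 = UNIV \<or> (\<exists>\<alpha>. \<phi>1 \<alpha> = 0 \<and> \<phi>2 \<alpha> \<noteq> 0)" if "\<epsilon> = 0"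
      using J2 nz2 cond that unfolding kernel_condition_def by auto
  qed (use J1 J2 additive.add[OF \<phi>1] additive.add[OF \<phi>2] in auto)
  then show ?thesis
    using nondegenerate_contact_bracket.simple_C_tilde nondegenerate_contact_bracket.codimension_le_1 by blast
qed

end
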